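(* Let $m,k\ge 1$ be integers, $n=k+m$, let $\Sigma(x)=\mathrm{diag}\big(-\lambda_1(x),\dots,-\lambda_k(x),\lambda_{k+1}(x),\dots,\lambda_{k+m}(x)\big)$ for $x\in[0,1]$, where $\lambda_1,\dots,\lambda_n$ are real-valued functions of class $C^1$ on $[0,1]$ satisfying $$-\lambda_1(x)<\cdots<-\lambda_k(x)<0<\lambda_{k+1}(x)<\cdots<\lambda_{k+m}(x)\quad\text{for all }x\in[0,1],$$ and let $B\in\mathcal B\subset\mathbb R^{k\times m}$ (the set $\mathcal B$ is defined in the context). There exists a constant $C\ge 1$, depending only on $B$ and $\Sigma$, such that the following holds. Let $w_0\in[L^\infty(0,1)]^n$ and let $w=(w_1,\dots,w_n)^{\mathsf T}$ be the broad solution on $[0,+\infty)\times(0,1)$ of $$\partial_t w(t,x)=\Sigma(x)\,\partial_x w(t,x),\qquad w_-(t,0)=B\,w_+(t,0),\qquad w(0,\cdot)=w_0,$$ with the feedback law at $x=1$ described in the context. Then for all $q\in[1,+\infty)$ and all $\Lambda\ge 1$, $$\|w(t,\cdot)\|_{L^q(0,1)}\le C e^{\Lambda(T_{opt}-t)}\|w(0,\cdot)\|_{L^q(0,1)}\quad\text{for all }t\ge 0.$$ As a consequence, for all $\Lambda\ge 1$, $$\|w(t,\cdot)\|_{L^\infty(0,1)}\le C e^{\Lambda(T_{opt}-t)}\|w(0,\cdot)\|_{L^\infty(0,1)}\quad\text{for all }t\ge 0.$$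
   Context: **Notation.** $w_-=(w_1,\dots,w_k)^{\mathsf T}$, $w_+=(w_{k+1},\dots,w_{k+m})^{\mathsf T}$. For $v\in[L^q(0,1)]^n$ with $1\le q<\infty$, $\|v\|_{L^q(0,1)}=\big(\int_0^1\sum_{i=1}^n|v_i(x)|^q\,dx\big)^{1/q}$; $\|v\|_{L^\infty(0,1)}=\max_i\|v_i\|_{L^\infty(0,1)}$. **Times.** $\tau_i=\int_0^1\frac{dx}{\lambda_i(x)}$ for $1\le i\le n$, and $$T_{opt}=\begin{cases}\max\{\tau_1+\tau_{m+1},\dots,\tau_k+\tau_{m+k},\ \tau_{k+1}\}&\text{if }m\ge k,\\ \max\{\tau_{k+1-m}+\tau_{k+1},\ \tau_{k+2-m}+\tau_{k+2},\dots,\tau_k+\tau_{k+m}\}&\text{if }m<k.\end{cases}$$ **The set $\mathcal B$.** $\mathcal B$ is the set of $B\in\mathbb R^{k\times m}$ such that for every $1\le i\le\min\{m-1,k\}$ the $i\times i$ matrix formed from the last $i$ rows and the last $i$ columns of $B$ is invertible. **Characteristics.** Extend each $\lambda_i$ to $\mathbb R$ by $\lambda_i(0)$ for $x<0$ and $\lambda_i(1)$ for $x>1$. For $s\ge0$, $\xi\in[0,1]$, let $t\mapsto x_i(t,s,\xi)$, $t\in\mathbb R$, solve $\frac{d}{dt}x_i(t,s,\xi)=\lambda_i(x_i(t,s,\xi))$ if $1\le i\le k$, and $\frac{d}{dt}x_i(t,s,\xi)=-\lambda_i(x_i(t,s,\xi))$ if $k+1\le i\le k+m$, with $x_i(s,s,\xi)=\xi$.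 For $k+1\le i<j\le k+m$ one has $x_i(0,\tau_j,0)\in[0,1]$. **The row vectors $M_i$.** Let $B\in\mathcal B$ and write $y=(y_{k+1},\dots,y_{k+m})^{\mathsf T}\in\mathbb R^m$, with $(By)_r$ the $r$-th entry of $By$, $1\le r\le k$. For $1\le l\le\min\{m-1,k\}$, $M_{k+1-l}\in\mathbb R^{1\times(m-l)}$ are the (uniquely determined, by Gaussian elimination) constant row vectors such that for each such $l$: $$(By)_k=(By)_{k-1}=\dots=(By)_{k+1-l}=0\iff y_{m+k+1-r}=M_{k+1-r}\,(y_{k+1},\dots,y_{m+k-r})^{\mathsf T}\ \text{ for all }1\le r\le l.$$ Thus $M_i$ has size $1\times(m+i-k-1)$. If $m\le k$, by convention $M_{k+1-m}=0$ (empty list of arguments, value $0$). **Feedback law at $x=1$.** Let $\ell=\max\{m,k\}$. For every $i$ with $\ell+1\le m+i\le m+k$, $$w_{m+i}(t,1)=M_i\Big(w_{k+1}\big(t,x_{k+1}(0,\tau_{m+i},0)\big),\dots,w_{m+i-1}\big(t,x_{m+i-1}(0,\tau_{m+i},0)\big)\Big)^{\mathsf T},\quad t\ge0,$$ and, if $m>k$, $w_j(t,1)=0$ for $k+1\le j\le m$, $t\ge 0$. (In particular $w_{k+1}(t,1)=0$ when $m\le k$.) **Broad solution.** $w$ is a function which, for every $T>0$, belongs to $[L^\infty((0,T)\times(0,1))]^n\cap[C([0,T];L^2(0,1))]^n\cap[C([0,1];L^2(0,T))]^n$, and satisfies the system along characteristics, i.e. for a.e. $(t,\xi)\in(0,+\infty)\times(0,1)$: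 - for $1\le i\le k$: $w_i(t,\xi)=w_{0,i}(x_i(0,t,\xi))$ if $x_i(0,t,\xi)>0$; otherwise $w_i(t,\xi)=(Bw_+(s,0))_i$, where $s\in[0,t]$ is such that $x_i(s,t,\xi)=0$; - for $k+1\le i\le k+m$: $w_i(t,\xi)=w_{0,i}(x_i(0,t,\xi))$ if $x_i(0,t,\xi)<1$; otherwise $w_i(t,\xi)$ equals the value at time $s$ of the feedback expression prescribed for $w_i(\cdot,1)$, where $s\in[0,t]$ is such that $x_i(s,t,\xi)=1$. For every $w_0\in[L^\infty(0,1)]^n$ such a solution exists and is unique (known fact). *)

theory Defs
  imports
    "HOL-Probability.Essential_Supremum"
    "Jordan_Normal_Form.Matrix"
begin

(* Components of n-vectors (n = k + m) keep the indices 1..n of the mathematics: lam i, w t i x.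
   Matrices and vectors of the matrix library are indexed from 0, so row r of B has index r - 1
   and y_(k+j) has index j - 1. *)

section \<open>Speeds, transport times and characteristics\<close>

definition C1_unit :: "(real \<Rightarrow> real) \<Rightarrow> bool" where
  "C1_unit f \<longleftrightarrow> (\<exists>f'. continuous_on {0..1} f' \<and>
     (\<forall>x\<in>{0..1}. (f has_real_derivative f' x) (at x within {0..1})))"

definition hyperbolic_speeds :: "nat \<Rightarrow> nat \<Rightarrow> (nat \<Rightarrow> real \<Rightarrow> real) \<Rightarrow> bool" where
  "hyperbolic_speeds k m lam \<longleftrightarrow>
     (\<forall>i\<in>{1..k + m}. C1_unit (lam i)) \<and>
     (\<forall>x\<in>{0..1}.
        (\<forall>i\<in>{1..<k}. - lam i x < - lam (i + 1) x) \<and>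
        - lam k x < 0 \<and> 0 < lam (k + 1) x \<and>
        (\<forall>i\<in>{k + 1..<k + m}. lam i x < lam (i + 1) x))"

definition tau :: "(nat \<Rightarrow> real \<Rightarrow> real) \<Rightarrow> nat \<Rightarrow> real" where
  "tau lam i = integral {0..1} (\<lambda>x. 1 / lam i x)"

definition T_opt :: "nat \<Rightarrow> nat \<Rightarrow> (nat \<Rightarrow> real \<Rightarrow> real) \<Rightarrow> real" where
  "T_opt k m lam =
     (if m \<ge> k then Max ((\<lambda>i. tau lam i + tau lam (m + i)) ` {1..k} \<union> {tau lam (k + 1)})
      else Max ((\<lambda>i. tau lam (k - m + i) + tau lam (k + i)) ` {1..m}))"

definition extend_const :: "(real \<Rightarrow> real) \<Rightarrow> real \<Rightarrow> real" where
  "extend_const f x = (if x < 0 then f 0 else if x > 1 then f 1 else f x)"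

(* X i t s xi is x_i(t, s, xi): the position at time t of the characteristic through xi at time s.
   The predicate determines X i t s xi uniquely for 1 <= i <= k + m, s >= 0 and 0 <= xi <= 1. *)
definition characteristics ::
  "nat \<Rightarrow> nat \<Rightarrow> (nat \<Rightarrow> real \<Rightarrow> real) \<Rightarrow> (nat \<Rightarrow> real \<Rightarrow> real \<Rightarrow> real \<Rightarrow> real) \<Rightarrow> bool" where
  "characteristics k m lam X \<longleftrightarrow>
     (\<forall>i\<in>{1..k + m}. \<forall>s\<ge>0. \<forall>\<xi>\<in>{0..1}.
        X i s s \<xi> = \<xi> \<and>
        (\<forall>t. ((\<lambda>t. X i t s \<xi>) has_real_derivative
               (if i \<le> k then extend_const (lam i) (X i t s \<xi>)
                else - extend_const (lam i) (X i t s \<xi>))) (at t)))"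

section \<open>The boundary matrix and the feedback law\<close>

definition B_set :: "nat \<Rightarrow> nat \<Rightarrow> real mat set" where
  "B_set k m = {B \<in> carrier_mat k m.
     \<forall>i\<in>{1..min (m - 1) k}. invertible_mat (mat i i (\<lambda>(a, b). B $$ (k - i + a, m - i + b)))}"

(* M i is the row vector M_i; for B in B_set k m the predicate determines it uniquely for
   k + 1 - min (m - 1) k <= i <= k, and for i = k + 1 - m if m <= k. *)
definition elimination_rows :: "nat \<Rightarrow> nat \<Rightarrow> real mat \<Rightarrow> (nat \<Rightarrow> real Matrix.vec) \<Rightarrow> bool" where
  "elimination_rows k m B M \<longleftrightarrow>
     (\<forall>l\<in>{1..min (m - 1) k}. M (k + 1 - l) \<in> carrier_vec (m - l) \<and>
        (\<forall>y\<in>carrier_vec m.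
           (\<forall>r\<in>{1..l}. vec_index (B *\<^sub>v y) (k - r) = 0) \<longleftrightarrow>
           (\<forall>r\<in>{1..l}. vec_index y (m - r) = scalar_prod (M (k + 1 - r)) (vec_first y (m - r))))) \<and>
     (m \<le> k \<longrightarrow> M (k + 1 - m) = 0\<^sub>v 0)"

(* The expression prescribed for w_j(t, 1), k + 1 <= j <= k + m, where j = m + i. If j <= max m k
   then m > k and j <= m. *)
definition feedback ::
  "nat \<Rightarrow> nat \<Rightarrow> (nat \<Rightarrow> real \<Rightarrow> real) \<Rightarrow> (nat \<Rightarrow> real \<Rightarrow> real \<Rightarrow> real \<Rightarrow> real) \<Rightarrow>
   (nat \<Rightarrow> real Matrix.vec) \<Rightarrow> (real \<Rightarrow> nat \<Rightarrow> real \<Rightarrow> real) \<Rightarrow> nat \<Rightarrow> real \<Rightarrow> real" where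
  "feedback k m lam X M w j t =
     (if max m k + 1 \<le> j
      then scalar_prod (M (j - m))
             (Matrix.vec (j - k - 1) (\<lambda>a. w t (k + 1 + a) (X (k + 1 + a) 0 (tau lam j) 0)))
      else 0)"

section \<open>Function spaces, norms and broad solutions\<close>

definition Linf_fun :: "'a::euclidean_space set \<Rightarrow> ('a \<Rightarrow> real) \<Rightarrow> bool" where
  "Linf_fun S f \<longleftrightarrow> f \<in> borel_measurable (lebesgue_on S) \<and>
     (\<exists>K. AE x in lebesgue_on S. \<bar>f x\<bar> \<le> K)"

definition L2_fun :: "real set \<Rightarrow> (real \<Rightarrow> real) \<Rightarrow> bool" where
  "L2_fun S f \<longleftrightarrow> f \<in> borel_measurable (lebesgue_on S) \<and>
     integrable (lebesgue_on S) (\<lambda>x. (f x)\<^sup>2)"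

definition continuous_into_L2 :: "real set \<Rightarrow> real set \<Rightarrow> (real \<Rightarrow> real \<Rightarrow> real) \<Rightarrow> bool" where
  "continuous_into_L2 I S u \<longleftrightarrow>
     (\<forall>a\<in>I. L2_fun S (u a)) \<and>
     (\<forall>a\<in>I. ((\<lambda>b. LINT x|lebesgue_on S. (u b x - u a x)\<^sup>2) \<longlongrightarrow> 0) (at a within I))"

definition Lq_norm :: "nat \<Rightarrow> real \<Rightarrow> (nat \<Rightarrow> real \<Rightarrow> real) \<Rightarrow> real" where
  "Lq_norm n q v =
     (LINT x|lebesgue_on {0<..<1}. (\<Sum>i = 1..n. \<bar>v i x\<bar> powr q)) powr (1 / q)"

definition Linf_norm :: "nat \<Rightarrow> (nat \<Rightarrow> real \<Rightarrow> real) \<Rightarrow> ereal" where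
  "Linf_norm n v =
     Max ((\<lambda>i. esssup (lebesgue_on {0<..<1}) (\<lambda>x. ereal \<bar>v i x\<bar>)) ` {1..n})"

(* w t i x is w_i(t, x). The function w is a representative for which w(t, .) is the value at t of
   w as an element of C([0,T]; L^2(0,1)) and w(., x) is the value at x of w as an element of
   C([0,1]; L^2(0,T)). The representatives of the two continuous functions can be merged into one
   by changing them on null sets, so every broad solution has such a representative. Each w(t, .)
   is then essentially bounded, so the integral in Lq_norm converges. *)
definition broad_solution ::
  "nat \<Rightarrow> nat \<Rightarrow> (nat \<Rightarrow> real \<Rightarrow> real) \<Rightarrow> real mat \<Rightarrow> (nat \<Rightarrow> real \<Rightarrow> real \<Rightarrow> real \<Rightarrow> real) \<Rightarrow>
   (nat \<Rightarrow> real Matrix.vec) \<Rightarrow> (nat \<Rightarrow> real \<Rightarrow> real) \<Rightarrow> (real \<Rightarrow> nat \<Rightarrow> real \<Rightarrow> real) \<Rightarrow> bool" where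
  "broad_solution k m lam B X M w0 w \<longleftrightarrow>
     (\<forall>T>0. \<forall>i\<in>{1..k + m}.
        Linf_fun ({0<..<T} \<times> {0<..<1}) (\<lambda>(t, x). w t i x) \<and>
        continuous_into_L2 {0..T} {0<..<1} (\<lambda>t x. w t i x) \<and>
        continuous_into_L2 {0..1} {0<..<T} (\<lambda>x t. w t i x)) \<and>
     (AE p in lebesgue_on ({0<..} \<times> {0<..<1}). case p of (t, \<xi>) \<Rightarrow>
        (\<forall>i\<in>{1..k}.
           if X i 0 t \<xi> > 0 then w t i \<xi> = w0 i (X i 0 t \<xi>)
           else (\<exists>s\<in>{0..t}. X i s t \<xi> = 0 \<and>
                   w t i \<xi> = vec_index (B *\<^sub>v Matrix.vec m (\<lambda>a. w s (k + 1 + a) 0)) (i - 1))) \<and>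
        (\<forall>i\<in>{k + 1..k + m}.
           if X i 0 t \<xi> < 1 then w t i \<xi> = w0 i (X i 0 t \<xi>)
           else (\<exists>s\<in>{0..t}. X i s t \<xi> = 1 \<and> w t i \<xi> = feedback k m lam X M w i s)))"

end

(* Let Phi_l be the antiderivative of 1/lambda_l vanishing at 0. Along characteristics
   t - Phi_l(x) (l <= k) or t + Phi_l(x) (l > k) is conserved, so every component has the form
   w_l(t,x) = F_l(t -+ Phi_l(x)) with a function F_l of one variable. The boundary conditions become
   pointwise relations between the signals: F_-(s) = B F_+(s), and for s > tau_j the feedback reads
   F_j(s) = M_{j-m} (F_{k+1}(s), ..., F_{j-1}(s)), or F_j(s) = 0. Hence |F(s)| is bounded by the
   initial data transported to s, which gives norm bounds uniform in q and t; moreover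
   F_j(s) = 0 for s > tau_{k+1}, and by the choice of M_i the row i of B F_+(s) vanishes once
   s > tau_{m+i}, so that w(t) = 0 for t > T_opt. For t <= T_opt the factor
   exp(Lambda (T_opt - t)) is at least 1, hence both facts together give the estimate. *)

theory Submission
  imports Defs
begin

section \<open>Changes of the time variable\<close>

text \<open>The obstacle is that the equations along characteristics hold only at almost every point
  of the plane, while the boundary condition, the feedback and the norms live on lines, which are
  null sets. Continuity in L^2 closes the gap: \<open>trace\<close> carries the representation of
  \<open>w\<close> to every single time and every single position. It needs integrable functions of
  one variable, hence the cut-off at a horizon \<open>T\<close>, which is later chosen beyond every
  argument that occurs at the time under study. One constant serves all exponents because the
  changes of variables contribute a factor \<open>R\<close> \<ge> 1 to the q-th power of the norm,
  and \<open>R powr (1 / q)\<close> \<le> \<open>R\<close>; the other factor enters as a q-th power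
  and is recovered exactly. The sup norm estimate comes from the same pointwise bound, not from
  letting q tend to infinity. The constant can be fixed before \<open>M\<close> because the
  elimination rows are unique.\<close>

locale time_change =
  fixes \<phi> p :: "real \<Rightarrow> real" and \<delta> D :: real
  assumes deriv: "\<And>x. (\<phi> has_real_derivative p x) (at x)"
    and cont: "continuous_on UNIV p"
    and low: "\<And>x. \<delta> \<le> p x" and up: "\<And>x. p x \<le> D" and delta_pos: "0 < \<delta>"
    and zero: "\<phi> 0 = 0"
begin

lemma pos: "0 < p x"
  using low[of x] delta_pos by linarith

lemma D_pos: "0 < D"
  using pos[of 0] up[of 0] by linarith

lemma continuous_phi: "continuous_on A \<phi>"
  by (meson DERIV_isCont continuous_at_imp_continuous_on deriv)

lemma less: "x < y \<Longrightarrow> \<phi> x < \<phi> y"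
  by (meson DERIV_pos_imp_increasing deriv pos)

lemma less_iff: "\<phi> x < \<phi> y \<longleftrightarrow> x < y"
  using less by (metis less_asym' linorder_neqE_linordered_idom)

lemma le_iff: "\<phi> x \<le> \<phi> y \<longleftrightarrow> x \<le> y"
  by (metis less_iff not_le)

lemma inj: "inj \<phi>"
  by (metis injI le_iff order_antisym order_refl)

text \<open>The slope is at least \<open>\<delta>\<close>, so \<open>\<phi>\<close> grows at least
  linearly in both directions and the intermediate value theorem reaches every value; positivity of
  the slope alone would not suffice.\<close>

lemma surj: "surj \<phi>"
proof -
  have grow: "\<delta> * (y - x) \<le> \<phi> y - \<phi> x" if "x \<le> y" for x y
  proof -
    have "\<phi> x - \<delta> * x \<le> \<phi> y - \<delta> * y"
      by (rule DERIV_nonneg_imp_nondecreasing[OF that, of "\<lambda>x. \<phi> x - \<delta> * x"])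
        (use low in \<open>auto intro!: exI[of _ "p _ - \<delta>"] derivative_eq_intros deriv\<close>)
    then show ?thesis by (simp add: algebra_simps)
  qed
  have "\<exists>x. \<phi> x = y" for y
  proof -
    define r where "r = \<bar>y\<bar> / \<delta>"
    have r: "0 \<le> r" "\<delta> * r = \<bar>y\<bar>" using delta_pos by (auto simp: r_def)
    have "\<phi> (- r) \<le> y" "y \<le> \<phi> r"
      using grow[of "- r" 0] grow[of 0 r] r zero by auto
    then show ?thesis
      using IVT'[of \<phi> "- r" y r] r continuous_phi by auto
  qed
  then show ?thesis by (metis surjI)
qed

lemma inv_phi [simp]: "inv_into UNIV \<phi> (\<phi> x) = x" "\<phi> (inv_into UNIV \<phi> y) = y"
  by (simp_all add: inj surj surj_f_inv_f)

lemma measurable_phi [measurable]: "\<phi> \<in> borel_measurable borel"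
  by (rule borel_measurable_continuous_onI[OF continuous_phi])

lemma measurable_p [measurable]: "p \<in> borel_measurable borel"
  by (rule borel_measurable_continuous_onI[OF cont])

text \<open>The substitution rule as an equality of measures. On intervals it is the fundamental
  theorem of calculus, and intervals determine Lebesgue measure. Statements on null sets and on
  integrals then transfer by rewriting with one equation.\<close>

lemma distr_phi: "distr (density lborel (\<lambda>x. ennreal (p x))) borel \<phi> = lborel"
proof (rule lborel_eqI[symmetric])
  fix l u :: real assume "\<And>b. b \<in> Basis \<Longrightarrow> l \<bullet> b \<le> u \<bullet> b"
  then have lu: "l \<le> u" by simp
  define a b where "a = inv_into UNIV \<phi> l" and "b = inv_into UNIV \<phi> u"
  have ab: "\<phi> a = l" "\<phi> b = u" by (auto simp: a_def b_def)
  then have "a \<le> b" using lu le_iff by metis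
  have vim: "\<phi> -` box l u = {a<..<b}"
    using ab less_iff by auto
  have "emeasure (distr (density lborel (\<lambda>x. ennreal (p x))) borel \<phi>) (box l u)
      = (\<integral>\<^sup>+ x. ennreal (p x) * indicator {a<..<b} x \<partial>lborel)"
    by (simp add: emeasure_distr vim[unfolded box_real] emeasure_density)
  also have "\<dots> = (\<integral>\<^sup>+ x. ennreal (p x) * indicator {a..b} x \<partial>lborel)"
  proof (rule nn_integral_cong_AE)
    have "AE x in lborel. x \<notin> {a, b}"
      by (rule AE_not_in[OF finite_imp_null_set_lborel]) auto
    then show "AE x in lborel. ennreal (p x) * indicator {a<..<b} x = ennreal (p x) * indicator {a..b} x"
      by eventually_elim (auto simp: indicator_def)
  qed
  also have "\<dots> = ennreal (\<phi> b - \<phi> a)"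
    by (rule nn_integral_FTC_Icc) (use \<open>a \<le> b\<close> deriv pos in \<open>auto intro: less_imp_le\<close>)
  finally show "emeasure (distr (density lborel (\<lambda>x. ennreal (p x))) borel \<phi>) (box l u) = (\<Prod>b\<in>Basis. (u - l) \<bullet> b)"
    using ab by simp
qed simp

text \<open>Translations and the reflection preserve Lebesgue measure. With \<open>c\<close> a time
  and \<open>\<epsilon>\<close> the direction of travel, the map sends a position to the label of
  the characteristic through it.\<close>

lemma distr_affine:
  assumes "\<bar>\<epsilon>\<bar> = 1"
  shows "distr (density lborel (\<lambda>x. ennreal (p x))) borel (\<lambda>x. c + \<epsilon> * \<phi> x) = lborel"
proof -
  have "lborel = density (distr lborel borel (\<lambda>x. c + \<epsilon> * x)) (\<lambda>_. 1)"
    using lborel_real_affine[of \<epsilon> c] assms by auto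
  then have "lborel = distr lborel borel (\<lambda>x. c + \<epsilon> * x)"
    by (simp add: density_1)
  also have "\<dots> = distr (density lborel (\<lambda>x. ennreal (p x))) borel ((\<lambda>x. c + \<epsilon> * x) \<circ> \<phi>)"
    by (subst distr_phi[symmetric], subst distr_distr) auto
  finally show ?thesis by (simp add: o_def)
qed

text \<open>Since \<open>p\<close> is positive, its density has the same null sets as
  \<open>lborel\<close>; so a relation known for almost every label holds at almost every
  position.\<close>

lemma AE_affine:
  assumes "AE s in lborel. P s" "\<bar>\<epsilon>\<bar> = 1"
  shows "AE x in lborel. P (c + \<epsilon> * \<phi> x)"
proof -
  have "AE s in distr (density lborel (\<lambda>x. ennreal (p x))) borel (\<lambda>x. c + \<epsilon> * \<phi> x). P s"
    using assms(1) by (simp only: distr_affine[OF assms(2)])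
  then have "AE x in density lborel (\<lambda>x. ennreal (p x)). P (c + \<epsilon> * \<phi> x)"
    by (rule AE_distrD[rotated]) simp
  then show ?thesis by (simp add: AE_density pos)
qed

lemma nn_integral_affine:
  assumes [measurable]: "f \<in> borel_measurable borel" and "\<bar>\<epsilon>\<bar> = 1"
  shows "(\<integral>\<^sup>+ x. ennreal (p x) * f (c + \<epsilon> * \<phi> x) \<partial>lborel) = (\<integral>\<^sup>+ s. f s \<partial>lborel)"
proof -
  have "(\<integral>\<^sup>+ s. f s \<partial>lborel)
      = (\<integral>\<^sup>+ s. f s \<partial>distr (density lborel (\<lambda>x. ennreal (p x))) borel (\<lambda>x. c + \<epsilon> * \<phi> x))"
    using assms(2) by (simp add: distr_affine)
  then show ?thesis
    by (simp add: nn_integral_distr nn_integral_density)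
qed

lemma integrable_affine:
  fixes f :: "real \<Rightarrow> real"
  assumes f: "integrable lborel f" and e: "\<bar>\<epsilon>\<bar> = 1"
  shows "integrable lborel (\<lambda>x. p x * f (c + \<epsilon> * \<phi> x))"
proof -
  have [measurable]: "f \<in> borel_measurable borel"
    using f by auto
  have "integrable (distr (density lborel (\<lambda>x. ennreal (p x))) borel (\<lambda>x. c + \<epsilon> * \<phi> x)) f"
    using e f by (simp add: distr_affine)
  then show ?thesis
    by (subst (asm) integrable_distr_eq) (auto simp: integrable_real_density pos less_imp_le)
qed

lemma integral_affine:
  fixes f :: "real \<Rightarrow> real"
  assumes [measurable]: "f \<in> borel_measurable borel" and e: "\<bar>\<epsilon>\<bar> = 1"
  shows "(LINT x|lborel. p x * f (c + \<epsilon> * \<phi> x)) = (LINT s|lborel. f s)"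
proof -
  have "(LINT s|lborel. f s)
      = (LINT s|distr (density lborel (\<lambda>x. ennreal (p x))) borel (\<lambda>x. c + \<epsilon> * \<phi> x). f s)"
    using assms(2) by (simp add: distr_affine)
  then show ?thesis
    by (simp add: integral_distr integral_real_density pos less_imp_le)
qed

text \<open>The slope bounds become reciprocal and swap places. All transfer lemmas are thereby
  available for the inverse as well, which transports initial data from positions to labels.\<close>

lemma inverse_time_change: "time_change (inv_into UNIV \<phi>) (\<lambda>s. 1 / p (inv_into UNIV \<phi> s)) (1 / D) (1 / \<delta>)"
proof
  have cinv: "continuous (at s) (inv_into UNIV \<phi>)" for s
  proof -
    have "isCont (inv_into UNIV \<phi>) (\<phi> (inv_into UNIV \<phi> s))"
      by (rule isCont_inverse_function[of 1]) (use deriv DERIV_isCont in auto)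
    then show ?thesis by simp
  qed
  fix s
  show "(inv_into UNIV \<phi> has_real_derivative 1 / p (inv_into UNIV \<phi> s)) (at s)"
  proof -
    have "(inv_into UNIV \<phi> has_real_derivative inverse (p (inv_into UNIV \<phi> s))) (at s)"
      by (rule DERIV_inverse_function[where f = \<phi> and a = "s - 1" and b = "s + 1"])
        (use deriv pos cinv in \<open>auto simp: less_imp_neq[symmetric]\<close>)
    then show ?thesis by (simp add: inverse_eq_divide)
  qed
  show "1 / D \<le> 1 / p (inv_into UNIV \<phi> s)" "1 / p (inv_into UNIV \<phi> s) \<le> 1 / \<delta>"
    using pos up low delta_pos by (auto intro!: divide_left_mono mult_pos_pos D_pos)
  show "continuous_on UNIV (\<lambda>s. 1 / p (inv_into UNIV \<phi> s))"
  proof (intro continuous_intros)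
    have "continuous_on UNIV (inv_into UNIV \<phi>)"
      using cinv by (simp add: continuous_at_imp_continuous_on)
    then show "continuous_on UNIV (\<lambda>s. p (inv_into UNIV \<phi> s))"
      by (rule continuous_on_compose2[OF cont]) auto
  qed (use pos less_imp_neq in metis)
next
  show "inv_into UNIV \<phi> 0 = 0" using inv_phi(1)[of 0] zero by simp
qed (simp add: D_pos)

end

text \<open>Covers time shifts, the reflection, and traces in which time itself is the variable of
  integration.\<close>

lemma time_change_id: "time_change (\<lambda>x. x) (\<lambda>_. 1) 1 1"
  by unfold_locales auto

section \<open>Traces of functions that are constant along characteristics\<close>

text \<open>The slices of a broad solution are only Lebesgue measurable, while substitutions are
  done on \<open>lborel\<close>; a Borel representative connects the two.\<close>

lemma integrable_lebesgue_borel_version: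
  fixes f :: "real \<Rightarrow> real"
  assumes "integrable lebesgue f"
  obtains g where "g \<in> borel_measurable borel" "integrable lborel g" "AE x in lborel. f x = g x"
    "AE x in lebesgue. f x = g x"
proof -
  obtain g where g: "g \<in> borel_measurable lborel" "AE x in lborel. f x = g x"
    using completion_ex_borel_measurable_real[of f lborel] assms by auto
  have ae: "AE x in lebesgue. f x = g x"
    using g(2) by (rule AE_completion)
  have "integrable lebesgue g"
    using assms g(1) ae by (subst integrable_cong_AE[OF _ _ AE_symmetric]) (auto simp: measurable_completion)
  then have "integrable lborel g"
    using g(1) by (simp add: integrable_completion)
  with g ae show ?thesis using that by auto
qed

text \<open>The positive and the negative part are densities of two measures that are finite and
  equal on all half-lines, hence equal. Uniqueness of densities makes both parts agree almost
  everywhere, which forces both to vanish.\<close>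

lemma AE_zero_if_integrals_zero:
  fixes f :: "real \<Rightarrow> real"
  assumes f: "integrable lborel f"
    and zero: "\<And>x. (LINT y|lborel. indicator {x<..} y * f y) = 0"
  shows "AE x in lborel. f x = 0"
proof -
  have [measurable]: "f \<in> borel_measurable borel" using f by auto
  let ?M = "density lborel (\<lambda>x. ennreal (f x))" and ?N = "density lborel (\<lambda>x. ennreal (- f x))"
  have int: "integrable lborel (\<lambda>y. indicator {x<..} y * f y)" for x
    using integrable_mult_indicator[OF _ f, of "{x<..}"] by simp
  have M: "emeasure ?M {x<..} = (\<integral>\<^sup>+ y. ennreal (indicator {x<..} y * f y) \<partial>lborel)" for x
    by (simp add: emeasure_density) (auto intro!: nn_integral_cong simp: indicator_def)
  have N: "emeasure ?N {x<..} = (\<integral>\<^sup>+ y. ennreal (- (indicator {x<..} y * f y)) \<partial>lborel)" for x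
    by (simp add: emeasure_density) (auto intro!: nn_integral_cong simp: indicator_def)
  have Mfin: "emeasure ?M {x<..} < \<infinity>" and Nfin: "emeasure ?N {x<..} < \<infinity>" for x
    using int[of x] unfolding M N real_integrable_def by (auto simp: less_top)
  have "emeasure ?M {x<..} = emeasure ?N {x<..}" for x
    using zero[of x] real_lebesgue_integral_def[OF int[of x]] Mfin[of x] Nfin[of x]
    unfolding M[symmetric] N[symmetric] by (metis ennreal_enn2real eq_iff_diff_eq_0 infinity_ennreal_def)
  then have "?M = ?N"
    by (intro measure_eqI_lessThan Mfin) auto
  then have "AE x in lborel. ennreal (f x) = ennreal (- f x)"
    by (intro sigma_finite_measure.density_unique[OF sigma_finite_lborel]) auto
  then show ?thesis
  proof eventually_elim
    case (elim x)
    then show ?case by (cases "0 \<le> f x") (auto simp: ennreal_eq_0_iff ennreal_neg)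
  qed
qed

text \<open>For fixed \<open>s\<close> away from the two ends of the window the indicator is locally
  constant in \<open>\<beta>\<close>; dominated convergence with majorant
  \<open>\<bar>F s\<bar>\<close> does the rest, without any continuity of \<open>F\<close>.\<close>

lemma continuous_window_integral:
  fixes F :: "real \<Rightarrow> real"
  assumes F: "integrable lborel F" and e: "\<bar>\<epsilon>\<bar> = 1"
  shows "continuous_on UNIV (\<lambda>\<beta>. LINT s|lborel. indicator {0<..<c} (\<epsilon> * (s - \<beta>)) * F s)"
proof (rule continuous_at_imp_continuous_on, intro ballI)
  fix \<beta> :: real
  have [measurable]: "F \<in> borel_measurable borel" using F by auto
  show "isCont (\<lambda>\<beta>. LINT s|lborel. indicator {0<..<c} (\<epsilon> * (s - \<beta>)) * F s) \<beta>"
    unfolding continuous_at_sequentially o_def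
  proof (intro allI impI)
    fix b :: "nat \<Rightarrow> real" assume b: "b \<longlonglongrightarrow> \<beta>"
    show "(\<lambda>n. LINT s|lborel. indicator {0<..<c} (\<epsilon> * (s - b n)) * F s)
        \<longlonglongrightarrow> (LINT s|lborel. indicator {0<..<c} (\<epsilon> * (s - \<beta>)) * F s)"
    proof (rule integral_dominated_convergence[where w = "\<lambda>s. \<bar>F s\<bar>"])
      have "AE s in lborel. s \<notin> {\<beta>, \<beta> + \<epsilon> * c}"
        by (rule AE_not_in[OF finite_imp_null_set_lborel]) auto
      then show "AE s in lborel. (\<lambda>n. indicator {0<..<c} (\<epsilon> * (s - b n)) * F s)
          \<longlonglongrightarrow> indicator {0<..<c} (\<epsilon> * (s - \<beta>)) * F s"
      proof eventually_elim
        case (elim s)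
        let ?y = "\<epsilon> * (s - \<beta>)"
        have y: "?y \<noteq> 0" "?y \<noteq> c"
          using elim e by (auto simp: abs_if split: if_splits)
        have lim: "(\<lambda>n. \<epsilon> * (s - b n)) \<longlonglongrightarrow> ?y"
          by (intro tendsto_intros b)
        have "eventually (\<lambda>n. indicator {0<..<c} (\<epsilon> * (s - b n)) * F s = indicator {0<..<c} ?y * F s) sequentially"
        proof (cases "?y \<in> {0<..<c}")
          case True
          have "eventually (\<lambda>n. \<epsilon> * (s - b n) \<in> {0<..<c}) sequentially"
            by (rule topological_tendstoD[OF lim]) (use True in auto)
          then show ?thesis by eventually_elim (use True in auto)
        next
          case False
          then have "?y \<in> {..<0} \<union> {c<..}" using y by (metis Un_iff greaterThanLessThan_iff greaterThan_iff lessThan_iff linorder_neqE_linordered_idom)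
          then have "eventually (\<lambda>n. \<epsilon> * (s - b n) \<in> {..<0} \<union> {c<..}) sequentially"
            by (intro topological_tendstoD[OF lim]) auto
          then show ?thesis
            by eventually_elim (use False in \<open>auto simp: indicator_def dest: less_asym\<close>)
        qed
        then show ?case by (rule tendsto_eventually)
      qed
    qed (use F in \<open>auto simp: indicator_def\<close>)
  qed
qed

lemma L2_fun_integrable:
  fixes f :: "real \<Rightarrow> real"
  assumes "L2_fun {0<..<L} f"
  shows "integrable (lebesgue_on {0<..<L}) f"
proof (rule Bochner_Integration.integrable_bound)
  show "integrable (lebesgue_on {0<..<L}) (\<lambda>x. 1 + (f x)\<^sup>2)"
    using assms by (auto simp: L2_fun_def intro!: Bochner_Integration.integrable_add finite_measure.integrable_const finite_measure_lebesgue_on)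
  show "f \<in> borel_measurable (lebesgue_on {0<..<L})"
    using assms by (simp add: L2_fun_def)
  have "\<bar>y\<bar> \<le> 1 + y\<^sup>2" for y :: real
    using zero_le_power2[of "\<bar>y\<bar> - 1"] zero_le_power2[of y]
    by (simp add: power2_eq_square algebra_simps)
  then show "AE x in lebesgue_on {0<..<L}. norm (f x) \<le> norm (1 + (f x)\<^sup>2)"
    by auto
qed

lemma L2_fun_diff_integrable:
  assumes "L2_fun S f" "L2_fun S g"
  shows "integrable (lebesgue_on S) (\<lambda>x. (f x - g x)\<^sup>2)"
proof (rule Bochner_Integration.integrable_bound)
  show "integrable (lebesgue_on S) (\<lambda>x. 2 * (f x)\<^sup>2 + 2 * (g x)\<^sup>2)"
    using assms by (auto simp: L2_fun_def)
  show "(\<lambda>x. (f x - g x)\<^sup>2) \<in> borel_measurable (lebesgue_on S)"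
    using assms by (auto simp: L2_fun_def)
  have "(a - b)\<^sup>2 \<le> 2 * a\<^sup>2 + 2 * b\<^sup>2" for a b :: real
    using zero_le_power2[of "a + b"] by (simp add: power2_eq_square algebra_simps)
  then show "AE x in lebesgue_on S. norm ((f x - g x)\<^sup>2) \<le> norm (2 * (f x)\<^sup>2 + 2 * (g x)\<^sup>2)"
    by auto
qed

text \<open>In place of the Cauchy-Schwarz inequality, |y| \<le> \<open>\<delta>\<close> + y^2 /
  \<open>\<delta>\<close> splits the difference into a small fixed part and a multiple of the
  squared L^2 distance.\<close>

lemma continuous_L2_pairing:
  assumes u: "continuous_into_L2 I {0<..<L} u" and L: "0 < L"
    and r: "r \<in> borel_measurable (lebesgue_on {0<..<L})" "\<And>b. \<bar>r b\<bar> \<le> D" and D: "0 < D"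
  shows "continuous_on I (\<lambda>a. LINT b|lebesgue_on {0<..<L}. r b * u a b)"
  unfolding continuous_on_def
proof (intro ballI tendstoI)
  let ?N = "lebesgue_on {0<..<L}"
  fix a e :: real assume a: "a \<in> I" and e: "0 < e"
  \<comment> \<open>Chosen so that the fixed part, integrated over the interval, is
    \<open>D * \<delta> * L\<close> = \<open>e / 2\<close>.\<close>
  define \<delta> where "\<delta> = e / (2 * D * L)"
  have d: "0 < \<delta>" using e D L by (simp add: \<delta>_def)
  have L2: "L2_fun {0<..<L} (u a)" if "a \<in> I" for a
    using u that by (auto simp: continuous_into_L2_def)
  have sqi: "integrable ?N (\<lambda>x. (u b x - u a x)\<^sup>2)" if "b \<in> I" for b
    by (rule L2_fun_diff_integrable) (use L2 a that in auto)
  have iu: "integrable ?N (u a)" if "a \<in> I" for a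
    by (rule L2_fun_integrable[OF L2[OF that]])
  have iru: "integrable ?N (\<lambda>b. r b * u a b)" if "a \<in> I" for a
  proof (rule Bochner_Integration.integrable_bound[of _ "\<lambda>b. D * u a b"])
    show "integrable ?N (\<lambda>b. D * u a b)" using iu[OF that] by simp
    show "AE x in ?N. norm (r x * u a x) \<le> norm (D * u a x)"
      using r(2) D by (intro AE_I2) (auto simp: abs_mult intro!: mult_right_mono)
    show "(\<lambda>b. r b * u a b) \<in> borel_measurable ?N"
      using r(1) iu[OF that] by auto
  qed
  have bound: "dist (LINT b|?N. r b * u b' b) (LINT b|?N. r b * u a b)
      \<le> e / 2 + D / \<delta> * (LINT x|?N. (u b' x - u a x)\<^sup>2)" if b': "b' \<in> I" for b'
  proof -
    have "dist (LINT b|?N. r b * u b' b) (LINT b|?N. r b * u a b) = norm (LINT b|?N. r b * u b' b - r b * u a b)"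
      using iru[OF b'] iru[OF a] by (simp add: dist_norm)
    also have "\<dots> \<le> (LINT b|?N. D * \<delta> + D / \<delta> * (u b' b - u a b)\<^sup>2)"
    proof (rule Bochner_Integration.integral_norm_bound_integral)
      show "integrable ?N (\<lambda>b. r b * u b' b - r b * u a b)"
        using iru[OF b'] iru[OF a] by simp
      show "integrable ?N (\<lambda>b. D * \<delta> + D / \<delta> * (u b' b - u a b)\<^sup>2)"
        using sqi[OF b'] by (auto intro!: Bochner_Integration.integrable_add finite_measure.integrable_const finite_measure_lebesgue_on)
      fix b
      have am: "\<bar>y\<bar> \<le> \<delta> + y\<^sup>2 / \<delta>" for y
      proof (cases "\<bar>y\<bar> \<le> \<delta>")
        case False
        then have "\<bar>y\<bar> * \<delta> \<le> \<bar>y\<bar> * \<bar>y\<bar>" by (intro mult_left_mono) auto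
        then have "\<bar>y\<bar> * \<delta> \<le> y\<^sup>2" by (simp add: power2_eq_square)
        then have "\<bar>y\<bar> \<le> y\<^sup>2 / \<delta>" using d by (simp add: field_simps)
        then show ?thesis using d by simp
      next
        case True
        moreover have "0 \<le> y\<^sup>2 / \<delta>" using d by simp
        ultimately show ?thesis by linarith
      qed
      have "norm (r b * u b' b - r b * u a b) = \<bar>r b\<bar> * \<bar>u b' b - u a b\<bar>"
        by (simp add: abs_mult[symmetric] right_diff_distrib)
      also have "\<dots> \<le> D * (\<delta> + (u b' b - u a b)\<^sup>2 / \<delta>)"
        by (rule mult_mono[OF r(2) am]) (use D in auto)
      finally show "norm (r b * u b' b - r b * u a b) \<le> D * \<delta> + D / \<delta> * (u b' b - u a b)\<^sup>2"
        by (simp add: algebra_simps)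
    qed
    also have "\<dots> = D * \<delta> * L + D / \<delta> * (LINT x|?N. (u b' x - u a x)\<^sup>2)"
      using sqi[OF b'] L
      by (subst Bochner_Integration.integral_add)
        (auto intro!: finite_measure.integrable_const finite_measure_lebesgue_on
          simp: measure_restrict_space)
    also have "D * \<delta> * L = e / 2" using D L by (simp add: \<delta>_def field_simps)
    finally show ?thesis .
  qed
  have lim: "((\<lambda>b. LINT x|?N. (u b x - u a x)\<^sup>2) \<longlongrightarrow> 0) (at a within I)"
    using u a by (auto simp: continuous_into_L2_def)
  have "eventually (\<lambda>b. (LINT x|?N. (u b x - u a x)\<^sup>2) < e * \<delta> / (2 * D)) (at a within I)"
    by (rule order_tendstoD(2)[OF lim]) (use e d D in simp)
  moreover have "eventually (\<lambda>b. b \<in> I) (at a within I)"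
    by (simp add: eventually_at_filter)
  ultimately show "eventually (\<lambda>b. dist (LINT c|?N. r c * u b c) (LINT c|?N. r c * u a c) < e) (at a within I)"
  proof eventually_elim
    case (elim b)
    have "D / \<delta> * (LINT x|?N. (u b x - u a x)\<^sup>2) < D / \<delta> * (e * \<delta> / (2 * D))"
      by (rule mult_strict_left_mono[OF elim(1)]) (use D d in simp)
    also have "\<dots> = e / 2" using D d by simp
    finally show ?case using bound[OF elim(2)] by linarith
  qed
qed

text \<open>The characteristic formula is only known almost everywhere in the plane. Integrated against
  the density \<open>p\<close> over a window \<open>{0<..<c}\<close>, both sides become continuous in \<open>a\<close>, so that it holds
  for every value of \<open>a\<close>.\<close>

lemma (in time_change) trace:
  assumes e: "\<bar>\<epsilon>\<bar> = 1" and F: "integrable lborel F" and \<alpha>: "continuous_on {0..R} \<alpha>"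
    and R: "0 < R" and L: "0 < L" and u: "continuous_into_L2 {0..R} {0<..<L} u"
    and ae: "AE a in lborel. a \<in> {0<..<R} \<longrightarrow>
      (AE b in lborel. b \<in> {0<..<L} \<longrightarrow> u a b = F (\<alpha> a + \<epsilon> * \<phi> b))"
    and a: "a \<in> {0..R}"
  shows "AE b in lborel. b \<in> {0<..<L} \<longrightarrow> u a b = F (\<alpha> a + \<epsilon> * \<phi> b)"
proof -
  let ?N = "lebesgue_on {0<..<L}"
  have [measurable]: "F \<in> borel_measurable borel" using F by auto
  define r where "r c b = indicator {0<..<c} b * p b" for c b
  define U where "U c a = (LINT b|?N. r c b * u a b)" for c a
  \<comment> \<open>The value of the right-hand side after substituting
    \<open>s = \<alpha> a + \<epsilon> * \<phi> b\<close>. The function \<open>F\<close> no longer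
    depends on \<open>a\<close>; only the window moves, and so continuity in \<open>a\<close> costs
    no regularity of \<open>F\<close>.\<close>
  define V where "V c a = (LINT s|lborel. indicator {0<..<\<phi> c} (\<epsilon> * (s - \<alpha> a)) * F s)" for c a
  have rD: "\<bar>r c b\<bar> \<le> D" for c b
    using up[of b] pos[of b] D_pos by (auto simp: r_def indicator_def)
  have rmb: "r c \<in> borel_measurable borel" for c
    unfolding r_def by measurable
  then have rm: "r c \<in> borel_measurable ?N" for c
    by (intro measurable_restrict_space1 measurable_completion) auto
  have Ucont: "continuous_on {0..R} (U c)" for c
    unfolding U_def by (rule continuous_L2_pairing[OF u L rm rD D_pos])
  have Vcont: "continuous_on {0..R} (V c)" for c
    unfolding V_def
    by (rule continuous_on_compose2[OF continuous_window_integral[OF F e] \<alpha>]) auto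
  have iF: "integrable lborel (\<lambda>b. r c b * F (\<alpha> a + \<epsilon> * \<phi> b))" for c a
    using integrable_mult_indicator[OF _ integrable_affine[OF F e, of "\<alpha> a"], of "{0<..<c}"]
    by (simp add: r_def mult.assoc)
  have iL: "integrable ?N (\<lambda>b. r c b * F (\<alpha> a + \<epsilon> * \<phi> b))" for c a
  proof -
    have "integrable lebesgue (\<lambda>b. r c b * F (\<alpha> a + \<epsilon> * \<phi> b))"
      using iF[of c a] integrable_completion[of "\<lambda>b. r c b * F (\<alpha> a + \<epsilon> * \<phi> b)" lborel] by auto
    then show ?thesis
      using integrable_mult_indicator[of "{0<..<L}" lebesgue "\<lambda>b. r c b * F (\<alpha> a + \<epsilon> * \<phi> b)"]
      by (subst integrable_restrict_space) auto
  qed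
  \<comment> \<open>For \<open>c \<le> L\<close> the window lies inside the interval, so restricting
    the measure to \<open>{0<..<L}\<close> loses nothing.\<close>
  have Veq: "V c a = (LINT b|?N. r c b * F (\<alpha> a + \<epsilon> * \<phi> b))" if c: "c \<le> L" for c a
  proof -
    have ee: "\<epsilon> * (\<epsilon> * x) = x" for x using e by (auto simp: abs_if split: if_splits)
    have "(LINT b|?N. r c b * F (\<alpha> a + \<epsilon> * \<phi> b))
        = (LINT b|lebesgue. indicator {0<..<L} b *\<^sub>R (r c b * F (\<alpha> a + \<epsilon> * \<phi> b)))"
      by (rule integral_restrict_space) auto
    also have "\<dots> = (LINT b|lebesgue. r c b * F (\<alpha> a + \<epsilon> * \<phi> b))"
      using c by (intro Bochner_Integration.integral_cong) (auto simp: r_def indicator_def)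
    also have "\<dots> = (LINT b|lborel. r c b * F (\<alpha> a + \<epsilon> * \<phi> b))"
      using iF[of c a] by (intro integral_completion) auto
    also have "\<dots> = (LINT b|lborel. p b * (indicator {0<..<\<phi> c} (\<epsilon> * ((\<alpha> a + \<epsilon> * \<phi> b) - \<alpha> a)) * F (\<alpha> a + \<epsilon> * \<phi> b)))"
      using less_iff[of 0] less_iff[of _ c] zero
      by (intro Bochner_Integration.integral_cong) (auto simp: r_def indicator_def ee)
    also have "\<dots> = V c a"
      unfolding V_def
      by (rule integral_affine[where f = "\<lambda>s. indicator {0<..<\<phi> c} (\<epsilon> * (s - \<alpha> a)) * F s"])
        (use e in auto)
    finally show ?thesis by simp
  qed
  have L2: "L2_fun {0<..<L} (u a)"
    using u a by (auto simp: continuous_into_L2_def)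
  have UV: "U c a = V c a" if c: "c \<le> L" for c
  proof -
    \<comment> \<open>The set where both continuous functions agree is closed and contains almost
      every point of the open interval, hence all of it and by closure also the ends 0 and
      \<open>R\<close>. The ends matter: they give the initial time and the boundary x = 0.\<close>
    let ?C = "{a \<in> {0..R}. U c a - V c a = 0}"
    have "closed ?C"
      by (intro continuous_closed_preimage_constant continuous_intros Ucont Vcont)
    moreover have "{0<..<R} \<subseteq> ?C"
    proof
      fix x assume x: "x \<in> {0<..<R}"
      have "AE x in lborel. x \<in> {0<..<R} \<longrightarrow> x \<in> ?C"
        using ae
      proof eventually_elim
        case (elim x)
        show ?case
        proof
          assume x: "x \<in> {0<..<R}"
          have "U c x = (LINT b|?N. r c b * F (\<alpha> x + \<epsilon> * \<phi> b))"
            unfolding U_def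
          proof (rule integral_cong_AE)
            show "AE b in ?N. r c b * u x b = r c b * F (\<alpha> x + \<epsilon> * \<phi> b)"
              using AE_completion[OF elim[rule_format, OF x]]
              by (subst AE_restrict_space_iff) auto
            have "L2_fun {0<..<L} (u x)"
              using u x by (auto simp: continuous_into_L2_def)
            then show "(\<lambda>b. r c b * u x b) \<in> borel_measurable ?N"
              using rm by (auto simp: L2_fun_def)
            show "(\<lambda>b. r c b * F (\<alpha> x + \<epsilon> * \<phi> b)) \<in> borel_measurable ?N"
              using iL by auto
          qed
          then show "x \<in> ?C" using x Veq[OF c] by auto
        qed
      qed
      then have "AE x in lebesgue. x \<in> {0<..<R} \<longrightarrow> x \<in> ?C"
        by (rule AE_completion)
      then have "AE x\<in>{0<..<R} in lebesgue. x \<in> ?C" by simp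
      then show "x \<in> ?C"
        by (rule mem_closed_if_AE_lebesgue_open[rotated 2, OF _ x]) (use \<open>closed ?C\<close> in auto)
    qed
    ultimately have "closure {0<..<R} \<subseteq> ?C"
      by (rule closure_minimal[rotated])
    then show ?thesis using R a by auto
  qed
  \<comment> \<open>The defect of the claim, weighted with the positive \<open>p\<close> and
    extended by 0; its integrals over windows \<open>{0<..<c}\<close> vanish for
    \<open>c \<le> L\<close>.\<close>
  define G where "G b = indicator {0<..<L} b *\<^sub>R (p b * (u a b - F (\<alpha> a + \<epsilon> * \<phi> b)))" for b
  have iru: "integrable ?N (\<lambda>b. r c b * u a b)" for c
  proof (rule Bochner_Integration.integrable_bound[of _ "\<lambda>b. D * u a b"])
    show "integrable ?N (\<lambda>b. D * u a b)" using L2_fun_integrable[OF L2] by simp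
    show "AE x in ?N. norm (r c x * u a x) \<le> norm (D * u a x)"
      using rD D_pos by (intro AE_I2) (auto simp: abs_mult intro!: mult_right_mono)
    show "(\<lambda>b. r c b * u a b) \<in> borel_measurable ?N"
      using rm L2 by (auto simp: L2_fun_def)
  qed
  have zero': "(LINT b|?N. r c b * (u a b - F (\<alpha> a + \<epsilon> * \<phi> b))) = 0" if "c \<le> L" for c
    using UV[OF that] iru[of c] iL[of c a] unfolding U_def Veq[OF that]
    by (simp add: right_diff_distrib)
  have iG: "integrable lebesgue G"
  proof -
    have "integrable ?N (\<lambda>b. r L b * (u a b - F (\<alpha> a + \<epsilon> * \<phi> b)))"
      using iru[of L] iL[of L a] by (simp add: right_diff_distrib)
    then have "integrable lebesgue (\<lambda>b. indicator {0<..<L} b *\<^sub>R (r L b * (u a b - F (\<alpha> a + \<epsilon> * \<phi> b))))"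
      by (subst (asm) integrable_restrict_space) auto
    also have "(\<lambda>b. indicator {0<..<L} b *\<^sub>R (r L b * (u a b - F (\<alpha> a + \<epsilon> * \<phi> b)))) = G"
      by (auto simp: G_def r_def indicator_def)
    finally show ?thesis .
  qed
  have Gc: "(LINT b|lebesgue. indicator {0<..<c} b * G b) = 0" if "c \<le> L" for c
  proof -
    have "(LINT b|lebesgue. indicator {0<..<c} b * G b)
       = (LINT b|lebesgue. indicator {0<..<L} b *\<^sub>R (r c b * (u a b - F (\<alpha> a + \<epsilon> * \<phi> b))))"
      using that by (intro Bochner_Integration.integral_cong) (auto simp: G_def r_def indicator_def)
    also have "\<dots> = (LINT b|?N. r c b * (u a b - F (\<alpha> a + \<epsilon> * \<phi> b)))"
      by (rule integral_restrict_space[symmetric]) auto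
    finally show ?thesis using zero'[OF that] by simp
  qed
  obtain g where g: "g \<in> borel_measurable borel" "integrable lborel g" "AE x in lborel. G x = g x"
    "AE x in lebesgue. G x = g x"
    using integrable_lebesgue_borel_version[OF iG] .
  have gc: "(LINT b|lborel. indicator {0<..<c} b * g b) = 0" if "c \<le> L" for c
  proof -
    have "(LINT b|lborel. indicator {0<..<c} b * g b) = (LINT b|lebesgue. indicator {0<..<c} b * g b)"
      using g(1) by (intro integral_completion[symmetric]) auto
    also have "\<dots> = (LINT b|lebesgue. indicator {0<..<c} b * G b)"
    proof (rule integral_cong_AE)
      show "(\<lambda>b. indicator {0<..<c} b * g b) \<in> borel_measurable lebesgue"
        using g(1) by (intro measurable_completion) auto
      show "(\<lambda>b. indicator {0<..<c} b * G b) \<in> borel_measurable lebesgue"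
        using integrable_mult_indicator[OF _ iG, of "{0<..<c}"] by auto
      show "AE b in lebesgue. indicator {0<..<c} b * g b = indicator {0<..<c} b * G b"
        using g(4) by eventually_elim auto
    qed
    finally show ?thesis using Gc[OF that] by simp
  qed
  have G0: "G b = 0" if "b \<notin> {0<..<L}" for b using that by (simp add: G_def)
  have "AE x in lborel. g x = 0"
  proof (rule AE_zero_if_integrals_zero[OF g(2)])
    fix x :: real
    have int: "integrable lborel (\<lambda>y. indicator {0<..<c} y * g y)" for c
      using integrable_mult_indicator[OF _ g(2), of "{0<..<c}"] by simp
    have "AE y in lborel. y \<notin> {x}"
      by (rule AE_not_in[OF finite_imp_null_set_lborel]) auto
    \<comment> \<open>A half-line is reached as a difference of two windows starting at 0, because
      the defect vanishes outside \<open>{0<..<L}\<close>; the single point \<open>x\<close> is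
      discarded as a null set.\<close>
    with g(3) have "AE y in lborel. indicator {x<..} y * g y
        = indicator {0<..<L} y * g y - indicator {0<..<min x L} y * g y"
    proof eventually_elim
      case (elim y)
      then have "y \<notin> {0<..<L} \<Longrightarrow> g y = 0" using G0[of y] by auto
      with elim show ?case by (cases "y \<in> {0<..<L}") (auto simp: indicator_def)
    qed
    then have "(LINT y|lborel. indicator {x<..} y * g y)
        = (LINT y|lborel. indicator {0<..<L} y * g y - indicator {0<..<min x L} y * g y)"
      using g(1) by (intro integral_cong_AE) auto
    also have "\<dots> = 0"
      using gc[of L] gc[of "min x L"] by (subst Bochner_Integration.integral_diff[OF int int]) auto
    finally show "(LINT y|lborel. indicator {x<..} y * g y) = 0" .
  qed
  with g(3) show ?thesis
  proof eventually_elim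
    case (elim b)
    then show ?case using pos[of b] by (auto simp: G_def)
  qed
qed

text \<open>The functions to which \<open>trace\<close> is applied are built from Lebesgue
  measurable slices of \<open>w\<close>, so integrability on \<open>lborel\<close> is available only
  up to a null set. The class is stable under all operations that build them.\<close>

definition ae_integrable :: "(real \<Rightarrow> real) \<Rightarrow> bool" where
  "ae_integrable f \<longleftrightarrow> (\<exists>g. integrable lborel g \<and> (AE x in lborel. f x = g x))"

lemma ae_integrable_cong:
  assumes "ae_integrable g" "AE x in lborel. f x = g x"
  shows "ae_integrable f"
proof -
  obtain h where h: "integrable lborel h" "AE x in lborel. g x = h x"
    using assms by (auto simp: ae_integrable_def)
  have "AE x in lborel. f x = h x"
    using assms(2) h(2) by eventually_elim simp
  with h show ?thesis by (auto simp: ae_integrable_def)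
qed

lemma ae_integrable_add:
  assumes "ae_integrable f" "ae_integrable g"
  shows "ae_integrable (\<lambda>x. f x + g x)"
proof -
  obtain f' g' where h: "integrable lborel f'" "AE x in lborel. f x = f' x"
    "integrable lborel g'" "AE x in lborel. g x = g' x"
    using assms by (auto simp: ae_integrable_def)
  have "AE x in lborel. f x + g x = f' x + g' x"
    using h(2,4) by eventually_elim simp
  with h show ?thesis
    unfolding ae_integrable_def by (intro exI[of _ "\<lambda>x. f' x + g' x"]) auto
qed

lemma ae_integrable_cmult:
  assumes "ae_integrable f"
  shows "ae_integrable (\<lambda>x. c * f x)"
proof -
  obtain f' where h: "integrable lborel f'" "AE x in lborel. f x = f' x"
    using assms by (auto simp: ae_integrable_def)
  have "AE x in lborel. c * f x = c * f' x"
    using h(2) by eventually_elim simp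
  with h show ?thesis
    unfolding ae_integrable_def by (intro exI[of _ "\<lambda>x. c * f' x"]) auto
qed

lemma ae_integrable_zero: "ae_integrable (\<lambda>x. 0)"
  unfolding ae_integrable_def by (intro exI[of _ "\<lambda>x. 0"]) auto

lemma ae_integrable_sum:
  "(\<And>i. i \<in> A \<Longrightarrow> ae_integrable (f i)) \<Longrightarrow> ae_integrable (\<lambda>x. \<Sum>i\<in>A. f i x)"
  by (induction A rule: infinite_finite_induct) (auto intro: ae_integrable_zero ae_integrable_add)

lemma ae_integrable_indicator:
  assumes "ae_integrable f" "A \<in> sets borel"
  shows "ae_integrable (\<lambda>x. indicator A x * f x)"
proof -
  obtain f' where h: "integrable lborel f'" "AE x in lborel. f x = f' x"
    using assms by (auto simp: ae_integrable_def)
  have "AE x in lborel. indicator A x * f x = indicator A x * f' x"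
    using h(2) by eventually_elim simp
  with h show ?thesis
    using integrable_mult_indicator[of A lborel f'] assms(2)
    unfolding ae_integrable_def by (intro exI[of _ "\<lambda>x. indicator A x * f' x"]) auto
qed

lemma ae_integrable_lebesgue_on:
  assumes "integrable (lebesgue_on S) f" "S \<in> sets borel"
  shows "ae_integrable (\<lambda>x. indicator S x * f x)"
proof -
  have "integrable lebesgue (\<lambda>x. indicator S x *\<^sub>R f x)"
    using assms by (subst (asm) integrable_restrict_space) auto
  then show ?thesis
    by (rule integrable_lebesgue_borel_version) (auto simp: ae_integrable_def)
qed

text \<open>\<open>integrable_affine\<close> carries the weight \<open>p\<close>; its lower bound
  \<open>\<delta>\<close> allows removing it.\<close>

lemma (in time_change) ae_integrable_affine:
  assumes f: "ae_integrable f" and e: "\<bar>\<epsilon>\<bar> = 1"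
  shows "ae_integrable (\<lambda>x. f (c + \<epsilon> * \<phi> x))"
proof -
  obtain g where g: "integrable lborel g" "AE x in lborel. f x = g x"
    using f by (auto simp: ae_integrable_def)
  have [measurable]: "g \<in> borel_measurable borel" using g by auto
  have "integrable lborel (\<lambda>x. g (c + \<epsilon> * \<phi> x))"
  proof (rule Bochner_Integration.integrable_bound)
    show "integrable lborel (\<lambda>x. (1 / \<delta>) * (p x * g (c + \<epsilon> * \<phi> x)))"
      using integrable_affine[OF g(1) e] by simp
    have "\<bar>y\<bar> \<le> 1 / \<delta> * (p x * \<bar>y\<bar>)" for x y
      using mult_right_mono[OF low[of x], of "\<bar>y\<bar>"] delta_pos by (simp add: field_simps)
    then show "AE x in lborel. norm (g (c + \<epsilon> * \<phi> x)) \<le> norm ((1 / \<delta>) * (p x * g (c + \<epsilon> * \<phi> x)))"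
      using delta_pos pos by (intro AE_I2) (simp add: abs_mult less_imp_le del: times_divide_eq_left)
  qed simp
  moreover have "AE x in lborel. f (c + \<epsilon> * \<phi> x) = g (c + \<epsilon> * \<phi> x)"
    by (rule AE_affine[OF g(2) e])
  ultimately show ?thesis by (auto simp: ae_integrable_def)
qed

lemma AE_lborel_neq: "AE x in lborel. x \<noteq> (c::real)"
  using AE_not_in[OF finite_imp_null_set_lborel[of "{c}"]] by simp

text \<open>Fubini for null sets in both orders: one for fixed time, one for fixed position. The
  property is first replaced by the complement of a measurable null set, since exchanging the
  quantifiers needs measurability.\<close>

lemma AE_lebesgue_on_Times:
  fixes P :: "real \<times> real \<Rightarrow> bool"
  assumes "AE z in lebesgue_on (S \<times> S'). P z" "S \<in> sets borel" "S' \<in> sets borel"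
  shows "AE x in lborel. x \<in> S \<longrightarrow> (AE y in lborel. y \<in> S' \<longrightarrow> P (x, y))"
    and "AE y in lborel. y \<in> S' \<longrightarrow> (AE x in lborel. x \<in> S \<longrightarrow> P (x, y))"
proof -
  have "S \<times> S' \<in> sets (lebesgue :: (real \<times> real) measure)"
    using borel_Times[OF assms(2,3)] by simp
  then have "AE z in lebesgue. z \<in> S \<times> S' \<longrightarrow> P z"
    using assms(1) by (subst (asm) AE_restrict_space_iff) auto
  then have "AE z in lborel \<Otimes>\<^sub>M lborel. z \<in> S \<times> S' \<longrightarrow> P z"
    unfolding AE_completion_iff lborel_prod .
  then obtain N where N: "N \<in> sets (lborel \<Otimes>\<^sub>M lborel)" "emeasure (lborel \<Otimes>\<^sub>M lborel) N = 0"
    "{z \<in> space (lborel \<Otimes>\<^sub>M lborel). \<not> (z \<in> S \<times> S' \<longrightarrow> P z)} \<subseteq> N"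
    by (rule AE_E)
  have sub: "x \<in> S \<Longrightarrow> y \<in> S' \<Longrightarrow> (x, y) \<notin> N \<Longrightarrow> P (x, y)" for x y
    using N(3) by (auto simp: space_pair_measure)
  have "AE z in lborel \<Otimes>\<^sub>M lborel. z \<notin> N"
    using N(1,2) by (intro AE_not_in) (auto simp: null_sets_def)
  then have 1: "AE x in lborel. AE y in lborel. (x, y) \<notin> N"
    by (rule lborel_pair.AE_pair)
  have "{x \<in> space (lborel \<Otimes>\<^sub>M lborel). (fst x, snd x) \<notin> N} = space (lborel \<Otimes>\<^sub>M lborel) - N"
    by auto
  with sets.compl_sets[OF N(1)]
  have meas: "{x \<in> space (lborel \<Otimes>\<^sub>M lborel). (fst x, snd x) \<notin> N} \<in> sets (lborel \<Otimes>\<^sub>M lborel)"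
    by (simp only:)
  have 2: "AE y in lborel. AE x in lborel. (x, y) \<notin> N"
    by (rule iffD1[OF lborel_pair.AE_commute[where P = "\<lambda>x y. (x, y) \<notin> N", OF meas] 1])
  show "AE x in lborel. x \<in> S \<longrightarrow> (AE y in lborel. y \<in> S' \<longrightarrow> P (x, y))"
    using 1
  proof eventually_elim
    case (elim x)
    then show ?case using sub by (auto elim!: eventually_mono)
  qed
  show "AE y in lborel. y \<in> S' \<longrightarrow> (AE x in lborel. x \<in> S \<longrightarrow> P (x, y))"
    using 2
  proof eventually_elim
    case (elim x)
    then show ?case using sub by (auto elim!: eventually_mono)
  qed
qed

section \<open>Travel times\<close>

text \<open>The signed travel time from 0 to x. With the speed extended to the line and bounded
  between positive constants it is a bijection of the line, so its inverse can be applied to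
  arbitrary labels.\<close>

definition clock :: "(real \<Rightarrow> real) \<Rightarrow> real \<Rightarrow> real" where
  "clock f = (SOME \<Phi>. \<Phi> 0 = 0 \<and> (\<forall>x. (\<Phi> has_real_derivative 1 / extend_const f x) (at x)))"

lemma extend_const_eq: "extend_const f x = f (max 0 (min 1 x))"
  by (auto simp: extend_const_def)

text \<open>The extended speed is \<open>f\<close> composed with the projection onto the unit
  interval, hence continuous with unchanged bounds; the slope of the clock is its reciprocal, so the
  bounds swap.\<close>

lemma time_change_clock:
  assumes f: "continuous_on {0..1} f" and c: "0 < c" and bounds: "\<And>x. x \<in> {0..1} \<Longrightarrow> c \<le> f x \<and> f x \<le> d"
  shows "time_change (clock f) (\<lambda>x. 1 / extend_const f x) (1 / d) (1 / c)"
proof -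
  have b: "c \<le> extend_const f x" "extend_const f x \<le> d" for x
    unfolding extend_const_eq using bounds[of "max 0 (min 1 x)"] by auto
  have pos: "0 < extend_const f x" for x using b(1)[of x] c by linarith
  have "continuous_on UNIV (\<lambda>x. f (max 0 (min 1 x)))"
    by (rule continuous_on_compose2[OF f]) (auto intro!: continuous_intros)
  then have cont: "continuous_on UNIV (\<lambda>x. 1 / extend_const f x)"
    using pos by (auto simp: extend_const_eq[symmetric] intro!: continuous_intros) (metis less_irrefl)
  then have "isCont (\<lambda>x. 1 / extend_const f x) x" for x
    by (simp add: continuous_on_eq_continuous_at)
  then obtain F where F: "\<And>x. (F has_vector_derivative 1 / extend_const f x) (at x)"
    using einterval_antiderivative[of "-\<infinity>" \<infinity> "\<lambda>x. 1 / extend_const f x"] by auto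
  have "(\<lambda>x. F x - F 0) 0 = 0 \<and>
      (\<forall>x. ((\<lambda>x. F x - F 0) has_real_derivative 1 / extend_const f x) (at x))"
    using F by (auto simp: has_real_derivative_iff_has_vector_derivative intro!: derivative_eq_intros)
  then have "\<exists>\<Phi>. \<Phi> 0 = 0 \<and> (\<forall>x. (\<Phi> has_real_derivative 1 / extend_const f x) (at x))"
    by (rule exI[of _ "\<lambda>x. F x - F 0"])
  from someI_ex[OF this] have clock: "clock f 0 = 0"
    "\<And>x. (clock f has_real_derivative 1 / extend_const f x) (at x)"
    by (auto simp: clock_def)
  show ?thesis
  proof
    fix x
    show "1 / d \<le> 1 / extend_const f x" "1 / extend_const f x \<le> 1 / c"
      using b[of x] pos[of x] c by (auto intro!: divide_left_mono)
    show "0 < 1 / d" using b[of 0] c by auto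
  qed (use clock cont in auto)
qed

lemma clock_one:
  assumes "time_change (clock f) (\<lambda>x. 1 / extend_const f x) \<delta> D"
  shows "clock f 1 = integral {0..1} (\<lambda>x. 1 / f x)"
proof -
  interpret time_change "clock f" "\<lambda>x. 1 / extend_const f x" \<delta> D by fact
  have "((\<lambda>x. 1 / extend_const f x) has_integral clock f 1 - clock f 0) {0..1}"
    by (rule fundamental_theorem_of_calculus)
      (use deriv in \<open>auto simp: has_real_derivative_iff_has_vector_derivative[symmetric]
        intro: has_field_derivative_at_within\<close>)
  then have "clock f 1 = integral {0..1} (\<lambda>x. 1 / extend_const f x)"
    using zero by (simp add: integral_unique)
  also have "\<dots> = integral {0..1} (\<lambda>x. 1 / f x)"
    by (rule integral_cong) (auto simp: extend_const_def)
  finally show ?thesis .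
qed

section \<open>Speeds\<close>

lemma hyperbolic_speeds_continuous:
  assumes "hyperbolic_speeds k m lam" "i \<in> {1..k + m}"
  shows "continuous_on {0..1} (lam i)"
proof -
  have "\<exists>f'. \<forall>x\<in>{0..1}. (lam i has_real_derivative f' x) (at x within {0..1})"
    using assms unfolding hyperbolic_speeds_def C1_unit_def by blast
  then show ?thesis
    by (meson DERIV_continuous continuous_on_eq_continuous_within)
qed

lemma hyperbolic_speeds_left:
  assumes "hyperbolic_speeds k m lam" "1 \<le> i" "i \<le> i'" "i' \<le> k" "x \<in> {0..1}"
  shows "lam i' x \<le> lam i x"
  using assms(3,4)
proof (induction i' rule: dec_induct)
  case (step n)
  have "lam (n + 1) x < lam n x"
    using assms step by (auto simp: hyperbolic_speeds_def)
  with step show ?case by auto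
qed simp

lemma hyperbolic_speeds_right:
  assumes "hyperbolic_speeds k m lam" "k + 1 \<le> j" "j \<le> j'" "j' \<le> k + m" "x \<in> {0..1}"
  shows "lam j x \<le> lam j' x"
  using assms(3,4)
proof (induction j' rule: dec_induct)
  case (step n)
  have "lam n x < lam (n + 1) x"
    using assms step by (auto simp: hyperbolic_speeds_def)
  with step show ?case by auto
qed simp

lemma hyperbolic_speeds_pos:
  assumes "hyperbolic_speeds k m lam" "i \<in> {1..k + m}" "x \<in> {0..1}"
  shows "0 < lam i x"
proof (cases "i \<le> k")
  case True
  have "lam k x \<le> lam i x"
    using assms True by (intro hyperbolic_speeds_left[of k m]) auto
  then show ?thesis using assms by (auto simp: hyperbolic_speeds_def intro: less_le_trans)
next
  case False
  have "lam (k + 1) x \<le> lam i x"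
    using assms False by (intro hyperbolic_speeds_right[of k m]) auto
  moreover have "0 < lam (k + 1) x"
    using assms by (auto simp: hyperbolic_speeds_def)
  ultimately show ?thesis by linarith
qed

lemma hyperbolic_speeds_bounds:
  assumes "hyperbolic_speeds k m lam"
  obtains c d where "0 < c" "c \<le> d" "\<And>i x. i \<in> {1..k + m} \<Longrightarrow> x \<in> {0..1} \<Longrightarrow> c \<le> lam i x \<and> lam i x \<le> d"
proof -
  have "\<exists>c d. 0 < c \<and> (\<forall>x\<in>{0..1}. c \<le> lam i x \<and> lam i x \<le> d)" if i: "i \<in> {1..k + m}" for i
  proof -
    note cont = hyperbolic_speeds_continuous[OF assms i]
    obtain x where x: "x \<in> {0..1}" "\<forall>y\<in>{0..1}. lam i x \<le> lam i y"
      using continuous_attains_inf[OF _ _ cont] by auto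
    obtain z where z: "z \<in> {0..1}" "\<forall>y\<in>{0..1}. lam i y \<le> lam i z"
      using continuous_attains_sup[OF _ _ cont] by auto
    show ?thesis
      using x z hyperbolic_speeds_pos[OF assms i x(1)] by blast
  qed
  then obtain c d where cd: "\<And>i. i \<in> {1..k + m} \<Longrightarrow> 0 < c i \<and> (\<forall>x\<in>{0..1}. c i \<le> lam i x \<and> lam i x \<le> (d i :: real))"
    by metis
  \<comment> \<open>The inserted 1 separates the two bounds: \<open>c' \<le> 1\<close> and
    \<open>1 \<le> d'\<close>, hence \<open>c' \<le> d'\<close>.\<close>
  define c' where "c' = Min (insert 1 (c ` {1..k + m}))"
  define d' where "d' = Max (insert 1 (d ` {1..k + m}))"
  have "0 < c'" unfolding c'_def using cd by (subst Min_gr_iff) auto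
  moreover have "c' \<le> 1" "1 \<le> d'" by (auto simp: c'_def d'_def)
  moreover have "c' \<le> lam i x \<and> lam i x \<le> d'" if "i \<in> {1..k + m}" "x \<in> {0..1}" for i x
  proof -
    have "c' \<le> c i" "d i \<le> d'" using that by (auto simp: c'_def d'_def simp del: Min_insert Max_insert intro!: Min_le Max_ge)
    then show ?thesis using cd[OF that(1)] that(2) by force
  qed
  ultimately show ?thesis using that[of c' d'] by force
qed

lemma tau_antimono:
  assumes "hyperbolic_speeds k m lam" "i \<in> {1..k + m}" "j \<in> {1..k + m}"
    and "\<And>x. x \<in> {0..1} \<Longrightarrow> lam i x \<le> lam j x"
  shows "tau lam j \<le> tau lam i"
proof -
  have int: "(\<lambda>x. 1 / lam l x) integrable_on {0..1}" if l: "l \<in> {1..k + m}" for l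
  proof (intro integrable_continuous_real continuous_intros hyperbolic_speeds_continuous[OF assms(1) l] ballI)
    fix x :: real assume "x \<in> {0..1}"
    then show "lam l x \<noteq> 0" using hyperbolic_speeds_pos[OF assms(1) l, of x] by simp
  qed
  show ?thesis
    unfolding tau_def
  proof (rule integral_le[OF int int])
    fix x :: real assume x: "x \<in> {0..1}"
    show "1 / lam j x \<le> 1 / lam i x"
      using assms(4)[OF x] hyperbolic_speeds_pos[OF assms(1,2) x] by (auto intro!: divide_left_mono)
  qed (use assms in auto)
qed

section \<open>Gaussian elimination\<close>

text \<open>The equations are triangular: the first \<open>m - l\<close> entries are free and each
  later entry is prescribed by its predecessors.\<close>

lemma elimination_rows_extend:
  assumes M: "elimination_rows k m B M" and l: "l \<le> min (m - 1) k" and v: "v \<in> carrier_vec (m - l)"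
  shows "\<exists>y\<in>carrier_vec m. vec_first y (m - l) = v \<and>
    (\<forall>r\<in>{1..l}. vec_index y (m - r) = scalar_prod (M (k + 1 - r)) (vec_first y (m - r)))"
  using l v
proof (induction l arbitrary: v)
  case 0
  then show ?case by (intro bexI[of _ v]) (auto simp: vec_first_def)
next
  case (Suc l)
  \<comment> \<open>Appends the first dependent entry, at index \<open>m - Suc l\<close>; the
    induction hypothesis fills in the remaining \<open>l\<close> entries.\<close>
  define v' where "v' = Matrix.vec (m - l) (\<lambda>a. if a < m - Suc l then vec_index v a else scalar_prod (M (k + 1 - Suc l)) v)"
  obtain y where y: "y \<in> carrier_vec m" "vec_first y (m - l) = v'"
    "\<forall>r\<in>{1..l}. vec_index y (m - r) = scalar_prod (M (k + 1 - r)) (vec_first y (m - r))"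
    using Suc.IH[of v'] Suc.prems(1) by (auto simp: v'_def)
  have yv: "vec_index y a = vec_index v' a" if "a < m - l" for a
    using that y(2) by (auto simp: vec_first_def)
  have first: "vec_first y (m - Suc l) = v"
    using Suc.prems by (intro eq_vecI) (auto simp: vec_first_def yv v'_def)
  have "vec_index y (m - Suc l) = scalar_prod (M (k + 1 - Suc l)) v"
    using Suc.prems by (subst yv) (auto simp: v'_def)
  with y(1,3) first show ?case
    by (intro bexI[of _ y]) (auto simp: le_Suc_eq)
qed

text \<open>Both row families describe the same zero set of the last rows of \<open>B\<close>. A
  vector from that set with a prescribed free part therefore satisfies both systems, and its entry
  at \<open>m - l\<close> is computed by either row.\<close>

lemma elimination_rows_unique:
  assumes M: "elimination_rows k m B M" and M': "elimination_rows k m B M'"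
    and l: "l \<in> {1..min (m - 1) k}"
  shows "M (k + 1 - l) = M' (k + 1 - l)"
proof (rule eq_vecI)
  have dim: "dim_vec (M (k + 1 - l)) = m - l" "dim_vec (M' (k + 1 - l)) = m - l"
    using assms by (auto simp: elimination_rows_def)
  then show "dim_vec (M (k + 1 - l)) = dim_vec (M' (k + 1 - l))" by simp
  fix a assume "a < dim_vec (M' (k + 1 - l))"
  then have a: "a < m - l" using dim by simp
  \<comment> \<open>A unit vector as free part reads off a single coefficient of the row.\<close>
  define v :: "real Matrix.vec" where "v = unit_vec (m - l) a"
  have v: "v \<in> carrier_vec (m - l)" by (simp add: v_def)
  obtain y where y: "y \<in> carrier_vec m" "vec_first y (m - l) = v"
    "\<forall>r\<in>{1..l}. vec_index y (m - r) = scalar_prod (M (k + 1 - r)) (vec_first y (m - r))"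
    using elimination_rows_extend[OF M _ v] l by auto
  have "\<forall>r\<in>{1..l}. vec_index (B *\<^sub>v y) (k - r) = 0"
    using M l y by (auto simp: elimination_rows_def)
  then have "\<forall>r\<in>{1..l}. vec_index y (m - r) = scalar_prod (M' (k + 1 - r)) (vec_first y (m - r))"
    using M' l y(1) unfolding elimination_rows_def by blast
  then have "scalar_prod (M (k + 1 - l)) v = scalar_prod (M' (k + 1 - l)) v"
    using y l by auto
  then show "vec_index (M (k + 1 - l)) a = vec_index (M' (k + 1 - l)) a"
    using a dim by (auto simp: v_def)
qed

text \<open>The bound has to be chosen before \<open>M\<close>. By uniqueness any one family
  \<open>M0\<close> yields it for all others, and if there is none the claim is empty.\<close>

lemma elimination_rows_bound:
  assumes "k \<ge> 1" "m \<ge> 1"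
  obtains A :: real where "A \<ge> 1"
    "\<And>M j. elimination_rows k m B M \<Longrightarrow> j \<in> {max m k + 1..k + m} \<Longrightarrow>
      (\<Sum>a<j - k - 1. \<bar>vec_index (M (j - m)) a\<bar>) \<le> A"
proof (cases "\<exists>M. elimination_rows k m B M")
  case True
  then obtain M0 where M0: "elimination_rows k m B M0" ..
  define S where "S j = (\<Sum>a<j - k - 1. \<bar>vec_index (M0 (j - m)) a\<bar>)" for j
  define A where "A = 1 + (\<Sum>j\<in>{max m k + 1..k + m}. S j)"
  have S0: "0 \<le> S j" for j by (auto simp: S_def intro: sum_nonneg)
  show ?thesis
  proof (rule that[of A])
    show "1 \<le> A" using S0 by (auto simp: A_def intro: sum_nonneg)
    fix M j assume M: "elimination_rows k m B M" and j: "j \<in> {max m k + 1..k + m}"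
    have "(\<Sum>a<j - k - 1. \<bar>vec_index (M (j - m)) a\<bar>) = S j"
    \<comment> \<open>For \<open>j = k + 1\<close> the corresponding \<open>l\<close> would be
      \<open>m\<close>, outside the range of uniqueness; there the sum is empty.\<close>
    proof (cases "j = k + 1")
      case False
      define l where "l = k + m + 1 - j"
      have "l \<in> {1..min (m - 1) k}" "j - m = k + 1 - l"
        using j False by (auto simp: l_def)
      then show ?thesis
        using elimination_rows_unique[OF M M0, of l] by (simp add: S_def)
    qed (simp add: S_def)
    also have "S j \<le> A"
      using member_le_sum[of j "{max m k + 1..k + m}" S] j S0 by (simp add: A_def)
    finally show "(\<Sum>a<j - k - 1. \<bar>vec_index (M (j - m)) a\<bar>) \<le> A" .
  qed
qed (use that[of 1] in auto)

section \<open>The closed-loop system\<close>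

text \<open>The sign with which the clock enters the label t + \<open>\<epsilon> l\<close> *
  \<open>\<Phi> l\<close> x of a characteristic: -1 for components moving to the right, 1 for those
  moving to the left. Both families share their lemmas through it.\<close>

definition orientation :: "nat \<Rightarrow> nat \<Rightarrow> real" where
  "orientation k l = (if l \<le> k then - 1 else 1)"

lemma abs_orientation [simp]: "\<bar>orientation k l\<bar> = 1"
  by (simp add: orientation_def)

text \<open>The common speed bounds \<open>lo\<close> and \<open>hi\<close> are parameters, so that
  constants built from them do not depend on the solution.\<close>

locale closed_loop =
  fixes k m :: nat and lam :: "nat \<Rightarrow> real \<Rightarrow> real" and B :: "real mat"
    and X :: "nat \<Rightarrow> real \<Rightarrow> real \<Rightarrow> real \<Rightarrow> real" and M :: "nat \<Rightarrow> real Matrix.vec"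
    and w0 :: "nat \<Rightarrow> real \<Rightarrow> real" and w :: "real \<Rightarrow> nat \<Rightarrow> real \<Rightarrow> real"
    and lo hi :: real
  assumes k: "k \<ge> 1" and m: "m \<ge> 1" and B: "B \<in> carrier_mat k m"
    and speeds: "hyperbolic_speeds k m lam"
    and lo: "0 < lo"
    and speed_bounds: "\<And>i x. i \<in> {1..k + m} \<Longrightarrow> x \<in> {0..1} \<Longrightarrow> lo \<le> lam i x \<and> lam i x \<le> hi"
    and chars: "characteristics k m lam X"
    and elim_rows: "elimination_rows k m B M"
    and data: "\<And>i. i \<in> {1..k + m} \<Longrightarrow> Linf_fun {0<..<1} (w0 i)"
    and broad: "broad_solution k m lam B X M w0 w"
begin

abbreviation \<Phi> :: "nat \<Rightarrow> real \<Rightarrow> real" where "\<Phi> l \<equiv> clock (lam l)"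
abbreviation \<tau> :: "nat \<Rightarrow> real" where "\<tau> l \<equiv> tau lam l"
abbreviation \<epsilon> :: "nat \<Rightarrow> real" where "\<epsilon> l \<equiv> orientation k l"

lemma time_change_\<Phi>:
  "l \<in> {1..k + m} \<Longrightarrow> time_change (\<Phi> l) (\<lambda>x. 1 / extend_const (lam l) x) (1 / hi) (1 / lo)"
  using speed_bounds lo by (intro time_change_clock hyperbolic_speeds_continuous[OF speeds]) auto

lemma \<Phi>_one: "l \<in> {1..k + m} \<Longrightarrow> \<Phi> l 1 = \<tau> l"
  unfolding tau_def by (rule clock_one[OF time_change_\<Phi>])

lemma \<Phi>_zero: "l \<in> {1..k + m} \<Longrightarrow> \<Phi> l 0 = 0"
  by (rule time_change.zero[OF time_change_\<Phi>])

lemma \<tau>_pos: "l \<in> {1..k + m} \<Longrightarrow> 0 < \<tau> l"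
  using time_change.less[OF time_change_\<Phi>, of l 0 1] by (simp add: \<Phi>_one \<Phi>_zero)

text \<open>The slope of the clock cancels the speed, leaving \<open>- \<epsilon> l\<close>, and
  \<open>\<epsilon> l\<close> squares to 1. Positions of characteristics are thus compared through
  clocks alone, even where they have left the unit interval.\<close>

lemma characteristic_invariant:
  assumes l: "l \<in> {1..k + m}" and t: "0 \<le> t" and \<xi>: "\<xi> \<in> {0..1}"
  shows "s + \<epsilon> l * \<Phi> l (X l s t \<xi>) = t + \<epsilon> l * \<Phi> l \<xi>"
proof -
  interpret time_change "\<Phi> l" "\<lambda>x. 1 / extend_const (lam l) x" "1 / hi" "1 / lo"
    by (rule time_change_\<Phi>[OF l])
  have X: "X l t t \<xi> = \<xi> \<and> (\<forall>s. ((\<lambda>s. X l s t \<xi>) has_real_derivative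
      (if l \<le> k then extend_const (lam l) (X l s t \<xi>) else - extend_const (lam l) (X l s t \<xi>))) (at s))"
    using chars l t \<xi> unfolding characteristics_def by blast
  then have init: "X l t t \<xi> = \<xi>" by simp
  have der: "((\<lambda>s. X l s t \<xi>) has_real_derivative - \<epsilon> l * extend_const (lam l) (X l s t \<xi>)) (at s)" for s
    using X[THEN conjunct2, THEN spec, of s] by (cases "l \<le> k") (simp_all add: orientation_def)
  have "((\<lambda>s. s + \<epsilon> l * \<Phi> l (X l s t \<xi>)) has_real_derivative 0) (at s)" for s
  proof -
    have ne: "extend_const (lam l) (X l s t \<xi>) \<noteq> 0"
      using pos[of "X l s t \<xi>"] by auto
    have "((\<lambda>s. \<Phi> l (X l s t \<xi>)) has_real_derivative
        1 / extend_const (lam l) (X l s t \<xi>) * (- \<epsilon> l * extend_const (lam l) (X l s t \<xi>))) (at s)"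
      by (rule DERIV_chain2[OF deriv der])
    then have "((\<lambda>s. \<Phi> l (X l s t \<xi>)) has_real_derivative - \<epsilon> l) (at s)"
      using ne by simp
    then have "((\<lambda>s. s + \<epsilon> l * \<Phi> l (X l s t \<xi>)) has_real_derivative 1 + \<epsilon> l * (- \<epsilon> l)) (at s)"
      by (auto intro!: derivative_eq_intros)
    then show ?thesis by (simp add: orientation_def split: if_splits)
  qed
  then have "s + \<epsilon> l * \<Phi> l (X l s t \<xi>) = t + \<epsilon> l * \<Phi> l (X l t t \<xi>)"
    by (intro DERIV_isconst_all) auto
  then show ?thesis by (simp add: init)
qed

text \<open>The component \<open>w_l(t,x)\<close> equals \<open>signal T l (t + \<epsilon> l * \<Phi> l x)\<close> on the time window
  \<open>(0,T)\<close>. The values outside the window are cut off to make the signals integrable on the line.\<close>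

definition initial :: "nat \<Rightarrow> real \<Rightarrow> real" where
  "initial l x = indicator {0<..<1} x * w0 l x"

definition signal :: "real \<Rightarrow> nat \<Rightarrow> real \<Rightarrow> real" where
  "signal T l s =
    (if l \<le> k
     then if s < 0 then initial l (inv_into UNIV (\<Phi> l) (- s))
       else if s < T then vec_index (B *\<^sub>v Matrix.vec m (\<lambda>a. w s (k + 1 + a) 0)) (l - 1) else 0
     else if s < \<tau> l then initial l (inv_into UNIV (\<Phi> l) s)
       else if s - \<tau> l < T then feedback k m lam X M w l (s - \<tau> l) else 0)"

text \<open>The label s = t - \<open>\<Phi> l \<xi>\<close> is the time at which the characteristic
  leaves x = 0. A negative s means that it started inside at time 0, at the point whose clock value
  is -s.\<close>

lemma signal_eq_left:
  assumes l: "l \<in> {1..k}" and t: "0 < t" "t < T" and \<xi>: "0 < \<xi>" "\<xi> < 1"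
    and w: "if X l 0 t \<xi> > 0 then w t l \<xi> = w0 l (X l 0 t \<xi>)
      else (\<exists>s\<in>{0..t}. X l s t \<xi> = 0 \<and>
        w t l \<xi> = vec_index (B *\<^sub>v Matrix.vec m (\<lambda>a. w s (k + 1 + a) 0)) (l - 1))"
  shows "w t l \<xi> = signal T l (t + \<epsilon> l * \<Phi> l \<xi>)"
proof -
  have l': "l \<in> {1..k + m}" and lk: "l \<le> k" using l by auto
  interpret time_change "\<Phi> l" "\<lambda>x. 1 / extend_const (lam l) x" "1 / hi" "1 / lo"
    by (rule time_change_\<Phi>[OF l'])
  have e: "\<epsilon> l = - 1" using lk by (simp add: orientation_def)
  define x where "x = X l 0 t \<xi>"
  have inv: "s - \<Phi> l (X l s t \<xi>) = t - \<Phi> l \<xi>" for s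
    using characteristic_invariant[OF l', of t \<xi> s] t \<xi> e by simp
  have x: "\<Phi> l x = \<Phi> l \<xi> - t" using inv[of 0] by (simp add: x_def)
  show ?thesis
  proof (cases "0 < x")
    case True
    have "\<Phi> l x < \<Phi> l 1" using x t less[OF \<xi>(2)] by simp
    then have "x < 1" using less_iff by simp
    moreover have "0 < \<Phi> l x" using less[OF True] zero by simp
    moreover have "w t l \<xi> = w0 l x" using w True by (simp add: x_def)
    ultimately show ?thesis
      using True lk x[symmetric] by (simp add: signal_def e initial_def)
  next
    case False
    then obtain s where s: "s \<in> {0..t}" "X l s t \<xi> = 0"
      "w t l \<xi> = vec_index (B *\<^sub>v Matrix.vec m (\<lambda>a. w s (k + 1 + a) 0)) (l - 1)"
      using w unfolding x_def by (metis (no_types, lifting))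
    then have "s = t - \<Phi> l \<xi>" using inv[of s] zero by simp
    then show ?thesis
      using s t lk by (simp add: signal_def e)
  qed
qed

text \<open>The label s = t + \<open>\<Phi> l \<xi>\<close> is the arrival time at x = 0, so the
  departure from x = 1 was at s - \<open>\<tau> l\<close>; the initial data is seen exactly when
  this is negative.\<close>

lemma signal_eq_right:
  assumes l: "l \<in> {k + 1..k + m}" and t: "0 < t" "t < T" and \<xi>: "0 < \<xi>" "\<xi> < 1"
    and w: "if X l 0 t \<xi> < 1 then w t l \<xi> = w0 l (X l 0 t \<xi>)
      else (\<exists>s\<in>{0..t}. X l s t \<xi> = 1 \<and> w t l \<xi> = feedback k m lam X M w l s)"
  shows "w t l \<xi> = signal T l (t + \<epsilon> l * \<Phi> l \<xi>)"
proof -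
  have l': "l \<in> {1..k + m}" and lk: "\<not> l \<le> k" using l by auto
  interpret time_change "\<Phi> l" "\<lambda>x. 1 / extend_const (lam l) x" "1 / hi" "1 / lo"
    by (rule time_change_\<Phi>[OF l'])
  have e: "\<epsilon> l = 1" using lk by (simp add: orientation_def)
  define x where "x = X l 0 t \<xi>"
  have inv: "s + \<Phi> l (X l s t \<xi>) = t + \<Phi> l \<xi>" for s
    using characteristic_invariant[OF l', of t \<xi> s] t \<xi> e by simp
  have x: "\<Phi> l x = t + \<Phi> l \<xi>" using inv[of 0] by (simp add: x_def)
  have x1: "x < 1 \<longleftrightarrow> t + \<Phi> l \<xi> < \<tau> l" using less_iff[of x 1] x \<Phi>_one[OF l'] by simp
  show ?thesis
  proof (cases "x < 1")
    case True
    have "\<Phi> l 0 < \<Phi> l x" using x t less[OF \<xi>(1)] by simp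
    then have "0 < x" using less_iff by simp
    moreover have "w t l \<xi> = w0 l x" using w True by (simp add: x_def)
    ultimately show ?thesis
      using True x1 lk x[symmetric] by (simp add: signal_def e initial_def)
  next
    case False
    then obtain s where s: "s \<in> {0..t}" "X l s t \<xi> = 1" "w t l \<xi> = feedback k m lam X M w l s"
      using w unfolding x_def by (metis (no_types, lifting))
    then have "t + \<Phi> l \<xi> - \<tau> l = s" using inv[of s] \<Phi>_one[OF l'] by simp
    then show ?thesis
      using s t False x1 lk by (simp add: signal_def e)
  qed
qed

text \<open>All components and all horizons share one null set, so the sections taken later need no
  countability argument. Membership in the domain is a premise because elimination of
  almost-everywhere facts does not supply it.\<close>

lemma broad_AE:
  "AE p in lebesgue_on ({0<..} \<times> {0<..<1}). p \<in> {0<..} \<times> {0<..<1} \<longrightarrow>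
     (\<forall>T l. l \<in> {1..k + m} \<longrightarrow> fst p < T \<longrightarrow>
       w (fst p) l (snd p) = signal T l (fst p + \<epsilon> l * \<Phi> l (snd p)))"
proof -
  have "AE p in lebesgue_on ({0<..} \<times> {0<..<1}). case p of (t, \<xi>) \<Rightarrow>
        (\<forall>i\<in>{1..k}.
           if X i 0 t \<xi> > 0 then w t i \<xi> = w0 i (X i 0 t \<xi>)
           else (\<exists>s\<in>{0..t}. X i s t \<xi> = 0 \<and>
                   w t i \<xi> = vec_index (B *\<^sub>v Matrix.vec m (\<lambda>a. w s (k + 1 + a) 0)) (i - 1))) \<and>
        (\<forall>i\<in>{k + 1..k + m}.
           if X i 0 t \<xi> < 1 then w t i \<xi> = w0 i (X i 0 t \<xi>)
           else (\<exists>s\<in>{0..t}. X i s t \<xi> = 1 \<and> w t i \<xi> = feedback k m lam X M w i s))"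
    using broad unfolding broad_solution_def by blast
  then show ?thesis
  proof eventually_elim
    case (elim p)
    obtain t \<xi> where p: "p = (t, \<xi>)" by (cases p)
    show ?case
    proof (intro impI allI)
      fix T l assume *: "p \<in> {0<..} \<times> {0<..<1}" "l \<in> {1..k + m}" "fst p < T"
      show "w (fst p) l (snd p) = signal T l (fst p + \<epsilon> l * \<Phi> l (snd p))"
      proof (cases "l \<le> k")
        case True
        then have l: "l \<in> {1..k}" using * by auto
        show ?thesis
          unfolding p fst_conv snd_conv
          by (rule signal_eq_left[OF l _ _ _ _ bspec[OF conjunct1[OF elim[unfolded p prod.case]] l]])
            (use * p in auto)
      next
        case False
        then have l: "l \<in> {k + 1..k + m}" using * by auto
        show ?thesis
          unfolding p fst_conv snd_conv
          by (rule signal_eq_right[OF l _ _ _ _ bspec[OF conjunct2[OF elim[unfolded p prod.case]] l]])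
            (use * p in auto)
      qed
    qed
  qed
qed

section \<open>Integrability of the signals\<close>

lemma initial_ae_integrable:
  assumes l: "l \<in> {1..k + m}"
  shows "ae_integrable (initial l)"
proof -
  obtain K where K: "w0 l \<in> borel_measurable (lebesgue_on {0<..<1})"
      "AE x in lebesgue_on {0<..<1}. \<bar>w0 l x\<bar> \<le> K"
    using data[OF l] by (auto simp: Linf_fun_def)
  have "integrable (lebesgue_on {0<..<1}) (w0 l)"
    by (rule finite_measure.integrable_const_bound[OF finite_measure_lebesgue_on, of _ _ K])
      (use K in auto)
  then show ?thesis
    unfolding initial_def by (rule ae_integrable_lebesgue_on) simp
qed

lemma initial_travel_ae_integrable:
  assumes l: "l \<in> {1..k + m}"
  shows "ae_integrable (\<lambda>s. initial l (inv_into UNIV (\<Phi> l) (\<epsilon> l * s)))"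
proof -
  have "ae_integrable (\<lambda>s. initial l (0 + 1 * inv_into UNIV (\<Phi> l) s))"
    by (rule time_change.ae_integrable_affine[OF time_change.inverse_time_change[OF time_change_\<Phi>[OF l]]
      initial_ae_integrable[OF l]]) simp
  then have "ae_integrable (\<lambda>s. initial l (inv_into UNIV (\<Phi> l) s))" by simp
  from time_change.ae_integrable_affine[OF time_change_id this abs_orientation, of 0 k l]
  show ?thesis by simp
qed

text \<open>Here continuity in x with values in L^2 in time enters: it makes the slice at every
  fixed x, also at x = 0, square integrable. The window includes 0 to match the branches of
  \<open>signal\<close>.\<close>

lemma w_time_ae_integrable:
  assumes l: "l \<in> {1..k + m}" and x: "x \<in> {0..1}" and T: "0 < T"
  shows "ae_integrable (\<lambda>s. indicator {0..<T} s * w s l x)"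
proof (rule ae_integrable_cong)
  have "L2_fun {0<..<T} (\<lambda>s. w s l x)"
    using broad l x T by (auto simp: broad_solution_def continuous_into_L2_def)
  then show "ae_integrable (\<lambda>s. indicator {0<..<T} s * w s l x)"
    by (intro ae_integrable_lebesgue_on L2_fun_integrable) auto
  show "AE s in lborel. indicator {0..<T} s * w s l x = indicator {0<..<T} s * w s l x"
    using AE_lborel_neq[of 0] by eventually_elim (auto simp: indicator_def)
qed

text \<open>The feedback for component j reads component j' at the point from which it needs exactly
  \<open>\<tau> j\<close> to reach x = 0. So all values read at one instant arrive there together
  with what is then sent from x = 1. The point lies in the unit interval because j' is not faster
  than j.\<close>

lemma feedback_position:
  assumes j: "j \<in> {k + 1..k + m}" and j': "j' \<in> {k + 1..j}"
  shows "X j' 0 (\<tau> j) 0 \<in> {0..1}" "\<Phi> j' (X j' 0 (\<tau> j) 0) = \<tau> j"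
proof -
  have l: "j' \<in> {1..k + m}" and lj: "j \<in> {1..k + m}" using j j' by auto
  interpret time_change "\<Phi> j'" "\<lambda>x. 1 / extend_const (lam j') x" "1 / hi" "1 / lo"
    by (rule time_change_\<Phi>[OF l])
  show eq: "\<Phi> j' (X j' 0 (\<tau> j) 0) = \<tau> j"
    using characteristic_invariant[OF l less_imp_le[OF \<tau>_pos[OF lj]], of 0 0] zero j'
    by (simp add: orientation_def)
  have "\<tau> j \<le> \<tau> j'"
    using j j' by (intro tau_antimono[OF speeds] hyperbolic_speeds_right[OF speeds]) auto
  then have "\<Phi> j' 0 \<le> \<Phi> j' (X j' 0 (\<tau> j) 0)" "\<Phi> j' (X j' 0 (\<tau> j) 0) \<le> \<Phi> j' 1"
    using eq \<tau>_pos[OF lj] \<Phi>_one[OF l] zero by auto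
  then show "X j' 0 (\<tau> j) 0 \<in> {0..1}" using le_iff by simp
qed

lemma boundary_value_sum:
  assumes "l \<in> {1..k}"
  shows "vec_index (B *\<^sub>v Matrix.vec m f) (l - 1) = (\<Sum>a<m. B $$ (l - 1, a) * f a)"
  using assms B by (auto simp: scalar_prod_def lessThan_atLeast0 intro!: sum.cong)

lemma feedback_sum:
  "max m k + 1 \<le> j \<Longrightarrow> feedback k m lam X M w j t =
    (\<Sum>a<j - k - 1. vec_index (M (j - m)) a * w t (k + 1 + a) (X (k + 1 + a) 0 (\<tau> j) 0))"
  by (auto simp: feedback_def scalar_prod_def lessThan_atLeast0 intro!: sum.cong)

lemma signal_ae_integrable:
  assumes l: "l \<in> {1..k + m}" and T: "0 < T"
  shows "ae_integrable (signal T l)"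
proof (cases "l \<le> k")
  case True
  have "ae_integrable (\<lambda>s. indicator {..<0} s * initial l (inv_into UNIV (\<Phi> l) (\<epsilon> l * s))
      + (\<Sum>a<m. B $$ (l - 1, a) * (indicator {0..<T} s * w s (k + 1 + a) 0)))"
    by (intro ae_integrable_add ae_integrable_sum ae_integrable_cmult ae_integrable_indicator
      initial_travel_ae_integrable w_time_ae_integrable l T) auto
  moreover have "signal T l s = indicator {..<0} s * initial l (inv_into UNIV (\<Phi> l) (\<epsilon> l * s))
      + (\<Sum>a<m. B $$ (l - 1, a) * (indicator {0..<T} s * w s (k + 1 + a) 0))" for s
    using True l boundary_value_sum[of l]
    by (auto simp: signal_def orientation_def indicator_def)
  ultimately show ?thesis by (rule ae_integrable_cong[OF _ AE_I2])
next
  case False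
  let ?f = "\<lambda>s. if max m k + 1 \<le> l then \<Sum>a<l - k - 1. vec_index (M (l - m)) a *
        (indicator {0..<T} s * w s (k + 1 + a) (X (k + 1 + a) 0 (\<tau> l) 0)) else 0"
  have "ae_integrable ?f"
  proof (cases "max m k + 1 \<le> l")
    case True
    then show ?thesis
      using False l T feedback_position[of l]
      by (auto intro!: ae_integrable_sum ae_integrable_cmult w_time_ae_integrable)
  qed (auto intro: ae_integrable_zero)
  \<comment> \<open>A label s uses the feedback at the departure time s - \<open>\<tau> l\<close>,
    hence the shift.\<close>
  then have "ae_integrable (\<lambda>s. ?f (- \<tau> l + 1 * s))"
    by (rule time_change.ae_integrable_affine[OF time_change_id]) simp
  then have "ae_integrable (\<lambda>s. indicator {..<\<tau> l} s * initial l (inv_into UNIV (\<Phi> l) (\<epsilon> l * s))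
      + ?f (- \<tau> l + 1 * s))"
    by (intro ae_integrable_add ae_integrable_indicator initial_travel_ae_integrable l) auto
  moreover have "signal T l s = indicator {..<\<tau> l} s * initial l (inv_into UNIV (\<Phi> l) (\<epsilon> l * s))
      + ?f (- \<tau> l + 1 * s)" for s
    using False feedback_sum[of l] by (auto simp: signal_def orientation_def indicator_def feedback_def)
  ultimately show ?thesis by (rule ae_integrable_cong[OF _ AE_I2])
qed

text \<open>\<open>trace\<close> with time as parameter and position as variable. Every t is
  reached, which a norm estimate valid for all t requires.\<close>

lemma trace_time:
  assumes l: "l \<in> {1..k + m}" and T: "0 < T" and t: "t \<in> {0..T}"
  shows "AE x in lborel. x \<in> {0<..<1} \<longrightarrow> w t l x = signal T l (t + \<epsilon> l * \<Phi> l x)"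
proof -
  interpret time_change "\<Phi> l" "\<lambda>x. 1 / extend_const (lam l) x" "1 / hi" "1 / lo"
    by (rule time_change_\<Phi>[OF l])
  obtain F where F: "integrable lborel F" "AE s in lborel. signal T l s = F s"
    using signal_ae_integrable[OF l T] by (auto simp: ae_integrable_def)
  have eq: "AE x in lborel. signal T l (t + \<epsilon> l * \<Phi> l x) = F (t + \<epsilon> l * \<Phi> l x)" for t
    by (rule AE_affine[OF F(2)]) simp
  have "AE x in lborel. x \<in> {0<..<1} \<longrightarrow> w t l x = F (t + \<epsilon> l * \<Phi> l x)"
  proof (rule trace[where \<alpha> = "\<lambda>t. t" and R = T and u = "\<lambda>t x. w t l x"])
    show "continuous_into_L2 {0..T} {0<..<1} (\<lambda>t x. w t l x)"
      using broad l T by (auto simp: broad_solution_def)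
    have "AE a in lborel. a \<in> {0<..} \<longrightarrow> (AE b in lborel. b \<in> {0<..<1} \<longrightarrow>
        (\<forall>T l. l \<in> {1..k + m} \<longrightarrow> a < T \<longrightarrow> w a l b = signal T l (a + \<epsilon> l * \<Phi> l b)))"
      using AE_lebesgue_on_Times(1)[OF broad_AE] by (auto elim!: eventually_mono)
    then show "AE a in lborel. a \<in> {0<..<T} \<longrightarrow>
        (AE b in lborel. b \<in> {0<..<1} \<longrightarrow> w a l b = F (a + \<epsilon> l * \<Phi> l b))"
    proof eventually_elim
      case (elim a)
      show ?case
      proof
        assume a: "a \<in> {0<..<T}"
        then have "AE b in lborel. b \<in> {0<..<1} \<longrightarrow>
            (\<forall>T l. l \<in> {1..k + m} \<longrightarrow> a < T \<longrightarrow> w a l b = signal T l (a + \<epsilon> l * \<Phi> l b))"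
          using elim by simp
        with eq[of a] show "AE b in lborel. b \<in> {0<..<1} \<longrightarrow> w a l b = F (a + \<epsilon> l * \<Phi> l b)"
          by eventually_elim (use a l in auto)
      qed
    qed
  qed (use F t T in \<open>auto intro: continuous_intros\<close>)
  with eq[of t] show ?thesis by eventually_elim simp
qed

text \<open>The roles are exchanged: the position is the parameter and enters through its clock
  value, and time is the variable. This reaches x = 0 and the individual points read by the
  feedback.\<close>

lemma trace_space:
  assumes l: "l \<in> {1..k + m}" and T: "0 < T" and x: "x \<in> {0..1}"
  shows "AE t in lborel. t \<in> {0<..<T} \<longrightarrow> w t l x = signal T l (t + \<epsilon> l * \<Phi> l x)"
proof -
  interpret time_change "\<lambda>x. x" "\<lambda>_. 1" 1 1 by (rule time_change_id)
  obtain F where F: "integrable lborel F" "AE s in lborel. signal T l s = F s"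
    using signal_ae_integrable[OF l T] by (auto simp: ae_integrable_def)
  have eq: "AE t in lborel. signal T l (\<epsilon> l * \<Phi> l x + 1 * t) = F (\<epsilon> l * \<Phi> l x + 1 * t)" for x
    by (rule AE_affine[OF F(2)]) simp
  have "AE t in lborel. t \<in> {0<..<T} \<longrightarrow> w t l x = F (\<epsilon> l * \<Phi> l x + 1 * t)"
  proof (rule trace[where \<alpha> = "\<lambda>x. \<epsilon> l * \<Phi> l x" and R = 1 and u = "\<lambda>x t. w t l x"])
    show "continuous_into_L2 {0..1} {0<..<T} (\<lambda>x t. w t l x)"
      using broad l T by (auto simp: broad_solution_def)
    show "continuous_on {0..1} (\<lambda>x. \<epsilon> l * \<Phi> l x)"
      by (intro continuous_intros time_change.continuous_phi[OF time_change_\<Phi>[OF l]])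
    have "AE a in lborel. a \<in> {0<..<1} \<longrightarrow> (AE b in lborel. b \<in> {0<..} \<longrightarrow>
        (\<forall>T l. l \<in> {1..k + m} \<longrightarrow> b < T \<longrightarrow> w b l a = signal T l (b + \<epsilon> l * \<Phi> l a)))"
      using AE_lebesgue_on_Times(2)[OF broad_AE] by (auto elim!: eventually_mono)
    then show "AE a in lborel. a \<in> {0<..<1} \<longrightarrow>
        (AE b in lborel. b \<in> {0<..<T} \<longrightarrow> w b l a = F (\<epsilon> l * \<Phi> l a + 1 * b))"
    proof eventually_elim
      case (elim a)
      show ?case
      proof
        assume a: "a \<in> {0<..<1}"
        then have "AE b in lborel. b \<in> {0<..} \<longrightarrow>
            (\<forall>T l. l \<in> {1..k + m} \<longrightarrow> b < T \<longrightarrow> w b l a = signal T l (b + \<epsilon> l * \<Phi> l a))"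
          using elim by simp
        with eq[of a] show "AE b in lborel. b \<in> {0<..<T} \<longrightarrow> w b l a = F (\<epsilon> l * \<Phi> l a + 1 * b)"
          by eventually_elim (use l in \<open>auto simp: add.commute\<close>)
      qed
    qed
  qed (use F x T in auto)
  with eq[of x] show ?thesis by eventually_elim (simp add: add.commute)
qed

end

text \<open>Strong induction gives \<open>A ^ (j - k) * h\<close>: a combination of predecessors
  costs at most one factor \<open>A\<close>, and \<open>A \<ge> 1\<close> absorbs the entries
  bounded directly.\<close>

lemma recursion_bound:
  fixes y :: "nat \<Rightarrow> real" and A h :: real
  assumes A: "A \<ge> 1" and h: "h \<ge> 0"
    and y: "\<And>j. j \<in> {k + 1..k + m} \<Longrightarrow> \<bar>y j\<bar> \<le> h \<or>
      (\<exists>v. y j = (\<Sum>a<j - k - 1. v a * y (k + 1 + a)) \<and> (\<Sum>a<j - k - 1. \<bar>v a\<bar>) \<le> A)"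
    and j: "j \<in> {k + 1..k + m}"
  shows "\<bar>y j\<bar> \<le> A ^ m * h"
proof -
  have "\<bar>y j\<bar> \<le> A ^ (j - k) * h"
    using j
  proof (induction j rule: less_induct)
    case (less j)
    consider "\<bar>y j\<bar> \<le> h"
      | v where "y j = (\<Sum>a<j - k - 1. v a * y (k + 1 + a))" "(\<Sum>a<j - k - 1. \<bar>v a\<bar>) \<le> A"
      using y[OF less.prems] by blast
    then show ?case
    proof cases
      case 1
      have "1 * h \<le> A ^ (j - k) * h"
        using A h by (intro mult_right_mono) auto
      then show ?thesis using 1 by simp
    next
      case 2
      have "\<bar>v a * y (k + 1 + a)\<bar> \<le> \<bar>v a\<bar> * (A ^ (j - k - 1) * h)" if a: "a < j - k - 1" for a
      proof -
        have "\<bar>y (k + 1 + a)\<bar> \<le> A ^ (k + 1 + a - k) * h"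
          using less.prems a by (intro less.IH) auto
        also have "\<dots> \<le> A ^ (j - k - 1) * h"
          using A h a by (intro mult_right_mono power_increasing) auto
        finally show ?thesis by (simp add: abs_mult mult_left_mono)
      qed
      then have "\<bar>y j\<bar> \<le> (\<Sum>a<j - k - 1. \<bar>v a\<bar> * (A ^ (j - k - 1) * h))"
        unfolding 2(1) by (intro order_trans[OF sum_abs] sum_mono) auto
      also have "\<dots> = (\<Sum>a<j - k - 1. \<bar>v a\<bar>) * (A ^ (j - k - 1) * h)"
        by (simp add: sum_distrib_right)
      also have "\<dots> \<le> A * (A ^ (j - k - 1) * h)"
        using 2(2) A h by (intro mult_right_mono) auto
      also have "\<dots> = A ^ Suc (j - k - 1) * h" by simp
      also have "Suc (j - k - 1) = j - k" using less.prems by auto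
      finally show ?thesis .
    qed
  qed
  also have "\<dots> \<le> A ^ m * h"
    using A h j by (intro mult_right_mono power_increasing) auto
  finally show ?thesis .
qed

text \<open>All that the proof uses about the optimal time, in a form without the distinction
  between \<open>m \<ge> k\<close> and \<open>m < k\<close>. The last inequality serves the rows too
  far up for the elimination to treat.\<close>

lemma tau_le_T_opt:
  assumes k: "k \<ge> 1" and m: "m \<ge> 1" and speeds: "hyperbolic_speeds k m lam"
    and pos: "\<And>i. i \<in> {1..k + m} \<Longrightarrow> 0 \<le> tau lam i"
  shows "tau lam (k + 1) \<le> T_opt k m lam"
    and "i \<in> {1..k} \<Longrightarrow> k + 1 < i + m \<Longrightarrow> tau lam i + tau lam (m + i) \<le> T_opt k m lam"
    and "i \<in> {1..k} \<Longrightarrow> i + m \<le> k + 1 \<Longrightarrow> tau lam i + tau lam (k + 1) \<le> T_opt k m lam"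
proof -
  let ?S = "(\<lambda>i. tau lam i + tau lam (m + i)) ` {1..k} \<union> {tau lam (k + 1)}"
  let ?S' = "(\<lambda>i. tau lam (k - m + i) + tau lam (k + i)) ` {1..m}"
  have ge: "x \<le> T_opt k m lam" if "m \<ge> k" "x \<in> ?S" for x
    using that unfolding T_opt_def by (auto intro!: Max_ge simp del: Max_insert)
  have lt: "tau lam (k - m + i) + tau lam (k + i) \<le> T_opt k m lam" if "m < k" "i \<in> {1..m}" for i
    using that unfolding T_opt_def by (auto intro!: Max_ge simp del: Max_insert)
  show "tau lam (k + 1) \<le> T_opt k m lam"
  proof (cases "m \<ge> k")
    case False
    have "0 \<le> tau lam (k - m + 1)" using False m by (intro pos) auto
    then show ?thesis using lt[of 1] False m by auto
  qed (auto intro: ge)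
  show "tau lam i + tau lam (m + i) \<le> T_opt k m lam" if i: "i \<in> {1..k}" "k + 1 < i + m"
  proof (cases "m \<ge> k")
    case False
    then have "i + m - k \<in> {1..m}" "k - m + (i + m - k) = i" "k + (i + m - k) = m + i"
      using i by auto
    then show ?thesis using lt[of "i + m - k"] False by simp
  qed (use i in \<open>auto intro: ge\<close>)
  show "tau lam i + tau lam (k + 1) \<le> T_opt k m lam" if i: "i \<in> {1..k}" "i + m \<le> k + 1"
  proof (cases "m \<ge> k")
    case True
    then have "m = k" "i = 1" using i by auto
    moreover have "tau lam 1 + tau lam (m + 1) \<in> ?S"
      using k by (intro UnI1 image_eqI[of _ _ 1]) auto
    ultimately show ?thesis using ge[OF True] by simp
  next
    case False
    \<comment> \<open>Speeds of the first block decrease with the index, so of these rows the one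
      with index \<open>k - m + 1\<close> has the longest travel time, and its sum occurs in the
      maximum.\<close>
    have "tau lam i \<le> tau lam (k - m + 1)"
      using i False m by (intro tau_antimono[OF speeds] hyperbolic_speeds_left[OF speeds]) auto
    then show ?thesis using lt[of 1] False m by auto
  qed
qed

section \<open>Pointwise relations between the signals\<close>

context closed_loop
begin

lemma \<tau>_right_antimono:
  "k + 1 \<le> j \<Longrightarrow> j \<le> j' \<Longrightarrow> j' \<le> k + m \<Longrightarrow> \<tau> j' \<le> \<tau> j"
  by (intro tau_antimono[OF speeds] hyperbolic_speeds_right[OF speeds]) auto

lemma signal_boundary:
  assumes i: "i \<in> {1..k}" and T: "0 < T"
  shows "AE s in lborel. s \<in> {0<..<T} \<longrightarrow>
    signal T i s = vec_index (B *\<^sub>v Matrix.vec m (\<lambda>a. signal T (k + 1 + a) s)) (i - 1)"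
proof -
  have "AE s in lborel. s \<in> {0<..<T} \<longrightarrow> w s (k + 1 + a) 0 = signal T (k + 1 + a) s" if "a < m" for a
    using trace_space[of "k + 1 + a" T 0] that T \<Phi>_zero[of "k + 1 + a"] by simp
  then have "AE s in lborel. \<forall>a\<in>{..<m}. s \<in> {0<..<T} \<longrightarrow> w s (k + 1 + a) 0 = signal T (k + 1 + a) s"
    by (intro eventually_ball_finite) auto
  then show ?thesis
  proof eventually_elim
    case (elim s)
    show ?case
    proof
      assume s: "s \<in> {0<..<T}"
      have "Matrix.vec m (\<lambda>a. w s (k + 1 + a) 0) = Matrix.vec m (\<lambda>a. signal T (k + 1 + a) s)"
        using elim s by (intro eq_vecI) auto
      then show "signal T i s = vec_index (B *\<^sub>v Matrix.vec m (\<lambda>a. signal T (k + 1 + a) s)) (i - 1)"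
        using i s by (simp add: signal_def)
    qed
  qed
qed

text \<open>By \<open>feedback_position\<close> every value read at time t carries the label t +
  \<open>\<tau> j\<close>, the same for all components; this turns the nonlocal feedback into a
  relation at a single label.\<close>

lemma signal_feedback:
  assumes j: "j \<in> {max m k + 1..k + m}" and T: "0 < T"
  shows "AE s in lborel. s \<in> {0<..<T} \<longrightarrow> \<tau> j < s \<longrightarrow>
    signal T j s = (\<Sum>a<j - k - 1. vec_index (M (j - m)) a * signal T (k + 1 + a) s)"
proof -
  have \<tau>: "0 < \<tau> j" using j by (intro \<tau>_pos) auto
  let ?z = "\<lambda>a. X (k + 1 + a) 0 (\<tau> j) 0"
  have "AE t in lborel. t \<in> {0<..<T} \<longrightarrow> w t (k + 1 + a) (?z a) = signal T (k + 1 + a) (t + \<tau> j)"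
    if a: "a < j - k - 1" for a
  proof -
    have "?z a \<in> {0..1}" "\<Phi> (k + 1 + a) (?z a) = \<tau> j"
      using feedback_position[of j "k + 1 + a"] j a by auto
    then show ?thesis
      using trace_space[of "k + 1 + a" T "?z a"] j a T by (auto simp: orientation_def)
  qed
  then have "AE t in lborel. \<forall>a\<in>{..<j - k - 1}. t \<in> {0<..<T} \<longrightarrow>
      w t (k + 1 + a) (?z a) = signal T (k + 1 + a) (t + \<tau> j)"
    by (intro eventually_ball_finite) auto
  then have "AE s in lborel. \<forall>a\<in>{..<j - k - 1}. - \<tau> j + 1 * s \<in> {0<..<T} \<longrightarrow>
      w (- \<tau> j + 1 * s) (k + 1 + a) (?z a) = signal T (k + 1 + a) (- \<tau> j + 1 * s + \<tau> j)"
    by (rule time_change.AE_affine[OF time_change_id]) simp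
  then show ?thesis
  proof eventually_elim
    case (elim s)
    show ?case
    proof (intro impI)
      assume s: "s \<in> {0<..<T}" "\<tau> j < s"
      then have "s - \<tau> j < T" using \<tau> by auto
      then have "signal T j s = feedback k m lam X M w j (s - \<tau> j)"
        using s j by (auto simp: signal_def)
      also have "\<dots> = (\<Sum>a<j - k - 1. vec_index (M (j - m)) a * w (s - \<tau> j) (k + 1 + a) (?z a))"
        using j by (intro feedback_sum) auto
      also have "\<dots> = (\<Sum>a<j - k - 1. vec_index (M (j - m)) a * signal T (k + 1 + a) s)"
        using elim s \<open>s - \<tau> j < T\<close> by (intro sum.cong) auto
      finally show "signal T j s = (\<Sum>a<j - k - 1. vec_index (M (j - m)) a * signal T (k + 1 + a) s)" .
    qed
  qed
qed

lemma signal_feedback_zero: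
  assumes j: "j \<in> {k + 1..max m k}" and s: "\<tau> j < s"
  shows "signal T j s = 0"
  using assms by (auto simp: signal_def feedback_def)

text \<open>The labels \<open>\<tau> j\<close> are discarded because they separate the initial data,
  seen before, from the feedback relation, known only after.\<close>

lemma signals_AE:
  assumes T: "0 < T"
  shows "AE s in lborel. s \<in> {0<..<T} \<longrightarrow>
    (\<forall>i\<in>{1..k}. signal T i s = vec_index (B *\<^sub>v Matrix.vec m (\<lambda>a. signal T (k + 1 + a) s)) (i - 1)) \<and>
    (\<forall>j\<in>{max m k + 1..k + m}. \<tau> j < s \<longrightarrow>
      signal T j s = (\<Sum>a<j - k - 1. vec_index (M (j - m)) a * signal T (k + 1 + a) s)) \<and>
    (\<forall>j\<in>{k + 1..k + m}. s \<noteq> \<tau> j)"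
proof -
  have "AE s in lborel. \<forall>i\<in>{1..k}. s \<in> {0<..<T} \<longrightarrow>
      signal T i s = vec_index (B *\<^sub>v Matrix.vec m (\<lambda>a. signal T (k + 1 + a) s)) (i - 1)"
    by (intro eventually_ball_finite ballI signal_boundary T) auto
  moreover have "AE s in lborel. \<forall>j\<in>{max m k + 1..k + m}. s \<in> {0<..<T} \<longrightarrow> \<tau> j < s \<longrightarrow>
      signal T j s = (\<Sum>a<j - k - 1. vec_index (M (j - m)) a * signal T (k + 1 + a) s)"
    by (intro eventually_ball_finite ballI signal_feedback T) auto
  moreover have "AE s in lborel. \<forall>j\<in>{k + 1..k + m}. s \<noteq> \<tau> j"
    by (intro eventually_ball_finite ballI AE_lborel_neq) auto
  ultimately show ?thesis
    by eventually_elim simp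
qed

text \<open>Vanishing of \<open>(By)_k, \<dots>, (By)_(k+1-l)\<close> is exactly what the feedback enforces for the traces
  \<open>y = w_+(s,0)\<close> as soon as the last \<open>l\<close> feedback laws have reached \<open>x = 0\<close>.\<close>

lemma eliminated_row:
  assumes i: "i \<in> {1..k}" "k + 1 < i + m"
    and y: "\<And>j. j \<in> {m + i..k + m} \<Longrightarrow> y j = (\<Sum>a<j - k - 1. vec_index (M (j - m)) a * y (k + 1 + a))"
  shows "vec_index (B *\<^sub>v Matrix.vec m (\<lambda>a. y (k + 1 + a))) (i - 1) = 0"
proof -
  define l where "l = k + 1 - i"
  define v where "v = Matrix.vec m (\<lambda>a. y (k + 1 + a))"
  have l: "l \<in> {1..min (m - 1) k}" using i by (auto simp: l_def)
  have v: "v \<in> carrier_vec m" by (simp add: v_def)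
  have "vec_index v (m - r) = scalar_prod (M (k + 1 - r)) (vec_first v (m - r))" if r: "r \<in> {1..l}" for r
  proof -
    \<comment> \<open>Counted from the end: entry \<open>m - r\<close> of the vector belongs to the
      component \<open>j\<close>, and its feedback row \<open>M (j - m)\<close> is the elimination
      row with index \<open>k + 1 - r\<close>.\<close>
    define j where "j = k + m + 1 - r"
    have j: "j \<in> {m + i..k + m}" "j - k - 1 = m - r" "j - m = k + 1 - r" "k + 1 + (m - r) = j"
      using r i by (auto simp: j_def l_def)
    have "vec_index v (m - r) = y j"
      using r l j by (auto simp: v_def)
    also have "\<dots> = (\<Sum>a<m - r. vec_index (M (k + 1 - r)) a * y (k + 1 + a))"
      using y[OF j(1)] j by simp
    also have "\<dots> = scalar_prod (M (k + 1 - r)) (vec_first v (m - r))"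
      by (auto simp: scalar_prod_def vec_first_def v_def lessThan_atLeast0 intro!: sum.cong)
    finally show ?thesis .
  qed
  then have "\<forall>r\<in>{1..l}. vec_index (B *\<^sub>v v) (k - r) = 0"
    using elim_rows l v unfolding elimination_rows_def by blast
  then have "vec_index (B *\<^sub>v v) (k - l) = 0" using l by auto
  moreover have "k - l = i - 1" using i by (auto simp: l_def)
  ultimately show ?thesis by (simp add: v_def)
qed

text \<open>A single function of the label that dominates the transported data of all components, so
  that it also bounds signals which mix them.\<close>

definition envelope :: "real \<Rightarrow> real" where
  "envelope s = (\<Sum>l\<in>{1..k + m}. \<bar>initial l (inv_into UNIV (\<Phi> l) (\<epsilon> l * s))\<bar>)"

lemma initial_le_envelope:
  "l \<in> {1..k + m} \<Longrightarrow> \<bar>initial l (inv_into UNIV (\<Phi> l) (\<epsilon> l * s))\<bar> \<le> envelope s"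
  unfolding envelope_def by (rule member_le_sum) auto

lemma envelope_nonneg: "0 \<le> envelope s"
  unfolding envelope_def by (intro sum_nonneg) auto

end

section \<open>Size and extinction of the signals\<close>

locale closed_loop_gain = closed_loop +
  fixes A b :: real
  assumes A: "A \<ge> 1" and b: "b \<ge> 1"
    and gain: "\<And>j. j \<in> {max m k + 1..k + m} \<Longrightarrow> (\<Sum>a<j - k - 1. \<bar>vec_index (M (j - m)) a\<bar>) \<le> A"
    and B_gain: "\<And>i. i \<in> {1..k} \<Longrightarrow> (\<Sum>a<m. \<bar>B $$ (i - 1, a)\<bar>) \<le> b"
begin

text \<open>The bound \<open>h\<close> on the components still carrying initial data is left free:
  the envelope yields the size estimate, and 0 yields extinction.\<close>

lemma signal_recursion_bound:
  assumes fb: "\<And>j. j \<in> {max m k + 1..k + m} \<Longrightarrow> \<tau> j < s \<Longrightarrow>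
      signal T j s = (\<Sum>a<j - k - 1. vec_index (M (j - m)) a * signal T (k + 1 + a) s)"
    and h: "0 \<le> h" and fresh: "\<And>j. j \<in> {k + 1..k + m} \<Longrightarrow> \<not> \<tau> j < s \<Longrightarrow> \<bar>signal T j s\<bar> \<le> h"
    and j: "j \<in> {k + 1..k + m}"
  shows "\<bar>signal T j s\<bar> \<le> A ^ m * h"
proof (rule recursion_bound[OF A h _ j])
  fix j assume j: "j \<in> {k + 1..k + m}"
  show "\<bar>signal T j s\<bar> \<le> h \<or> (\<exists>v. signal T j s = (\<Sum>a<j - k - 1. v a * signal T (k + 1 + a) s) \<and>
      (\<Sum>a<j - k - 1. \<bar>v a\<bar>) \<le> A)"
  proof (cases "\<tau> j < s")
    case True
    show ?thesis
    proof (cases "j \<le> max m k")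
      case True
      then show ?thesis using signal_feedback_zero[of j s T] \<open>\<tau> j < s\<close> j h by auto
    next
      case False
      then have "j \<in> {max m k + 1..k + m}" using j by auto
      then show ?thesis using fb gain True by blast
    qed
  qed (use fresh j in auto)
qed

text \<open>The feedback chain costs \<open>A ^ m\<close> and the reflection at x = 0 one factor
  \<open>b\<close>. Nonpositive labels occur inside the domain only for the components with
  \<open>l \<le> k\<close>, hence the second premise.\<close>

lemma signal_bound:
  assumes l: "l \<in> {1..k + m}" and T: "0 < T"
  shows "AE s in lborel. s < T \<longrightarrow> (l \<le> k \<or> 0 < s) \<longrightarrow> \<bar>signal T l s\<bar> \<le> b * A ^ m * envelope s"
  using signals_AE[OF T] AE_lborel_neq[of 0]
proof eventually_elim
  case (elim s)
  have Am: "1 \<le> A ^ m" using A by simp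
  show ?case
  proof (intro impI)
    assume s: "s < T" "l \<le> k \<or> 0 < s"
    have right: "\<bar>signal T j s\<bar> \<le> A ^ m * envelope s" if j: "j \<in> {k + 1..k + m}" and "0 < s" for j
    proof (rule signal_recursion_bound[OF _ envelope_nonneg _ j])
      fix j assume j: "j \<in> {k + 1..k + m}" and "\<not> \<tau> j < s"
      moreover have "s \<noteq> \<tau> j" using elim(1) s \<open>0 < s\<close> j by (simp del: atLeastAtMost_iff)
      ultimately have "s < \<tau> j" by simp
      then have "signal T j s = initial j (inv_into UNIV (\<Phi> j) (\<epsilon> j * s))"
        using j by (auto simp: signal_def orientation_def)
      then show "\<bar>signal T j s\<bar> \<le> envelope s"
        using initial_le_envelope[of j s] j by simp
    qed (use elim(1) s \<open>0 < s\<close> in \<open>simp del: atLeastAtMost_iff\<close>)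
    show "\<bar>signal T l s\<bar> \<le> b * A ^ m * envelope s"
    proof (cases "0 < s")
      case True
      show ?thesis
      proof (cases "l \<le> k")
        case lk: True
        then have l': "l \<in> {1..k}" using l by auto
        have "signal T l s = vec_index (B *\<^sub>v Matrix.vec m (\<lambda>a. signal T (k + 1 + a) s)) (l - 1)"
          using elim(1) s True l' by (simp del: atLeastAtMost_iff)
        then have "\<bar>signal T l s\<bar> = \<bar>\<Sum>a<m. B $$ (l - 1, a) * signal T (k + 1 + a) s\<bar>"
          by (simp only: boundary_value_sum[OF l'])
        also have "\<dots> \<le> (\<Sum>a<m. \<bar>B $$ (l - 1, a)\<bar> * (A ^ m * envelope s))"
          using right[OF _ True]
          by (intro order_trans[OF sum_abs] sum_mono) (auto simp: abs_mult intro!: mult_left_mono)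
        also have "\<dots> = (\<Sum>a<m. \<bar>B $$ (l - 1, a)\<bar>) * (A ^ m * envelope s)"
          by (simp add: sum_distrib_right)
        also have "\<dots> \<le> b * (A ^ m * envelope s)"
          using B_gain[OF l'] Am envelope_nonneg by (intro mult_right_mono) auto
        finally show ?thesis by (simp add: mult.assoc)
      next
        case False
        then have "\<bar>signal T l s\<bar> \<le> A ^ m * envelope s" using right[OF _ True] l by auto
        also have "\<dots> \<le> b * (A ^ m * envelope s)"
          using b Am envelope_nonneg[of s] mult_right_mono[of 1 b "A ^ m * envelope s"] by auto
        finally show ?thesis by (simp add: mult.assoc)
      qed
    next
      case False
      then have "s < 0" "l \<le> k" using elim(2) s by auto
      then have "signal T l s = initial l (inv_into UNIV (\<Phi> l) (\<epsilon> l * s))"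
        by (simp add: signal_def orientation_def)
      then have "\<bar>signal T l s\<bar> \<le> 1 * envelope s"
        using initial_le_envelope[OF l, of s] by simp
      also have "\<dots> \<le> (b * A ^ m) * envelope s"
        using mult_mono[of 1 b 1 "A ^ m"] b Am envelope_nonneg by (intro mult_right_mono) auto
      finally show ?thesis .
    qed
  qed
qed

text \<open>At time t and x in the open unit interval the label exceeds t - \<open>\<tau> l\<close>
  for \<open>l \<le> k\<close> and t otherwise, which explains the threshold. Row l of the boundary
  condition vanishes by elimination once the slowest of its laws, with travel time
  \<open>\<tau> (m + l)\<close>, has arrived.\<close>

lemma signal_vanishes:
  assumes l: "l \<in> {1..k + m}" and T: "0 < T"
  shows "AE s in lborel. s < T \<longrightarrow> T_opt k m lam - (if l \<le> k then \<tau> l else 0) < s \<longrightarrow> signal T l s = 0"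
  using signals_AE[OF T]
proof eventually_elim
  case (elim s)
  have \<tau>: "0 < \<tau> i" if "i \<in> {1..k + m}" for i using \<tau>_pos[OF that] .
  have opt: "\<tau> (k + 1) \<le> T_opt k m lam"
    "l \<in> {1..k} \<Longrightarrow> k + 1 < l + m \<Longrightarrow> \<tau> l + \<tau> (m + l) \<le> T_opt k m lam"
    "l \<in> {1..k} \<Longrightarrow> l + m \<le> k + 1 \<Longrightarrow> \<tau> l + \<tau> (k + 1) \<le> T_opt k m lam"
    using tau_le_T_opt[OF k m speeds] \<tau> less_imp_le by blast+
  show ?case
  proof (intro impI)
    assume s: "s < T" "T_opt k m lam - (if l \<le> k then \<tau> l else 0) < s"
    have right: "signal T j s = 0" if j: "j \<in> {k + 1..k + m}" and s1: "\<tau> (k + 1) < s" for j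
    proof -
      have late: "\<tau> i < s" if "i \<in> {k + 1..k + m}" for i
        using \<tau>_right_antimono[of "k + 1" i] that s1 by auto
      have "0 < s" using \<tau>[of "k + 1"] m s1 by auto
      \<comment> \<open>No component carries initial data any more, so the recursion starts from
        0.\<close>
      then have "\<bar>signal T j s\<bar> \<le> A ^ m * 0"
        by (intro signal_recursion_bound[OF _ order_refl _ j])
          (use elim s late in \<open>simp_all del: atLeastAtMost_iff\<close>)
      then show ?thesis by simp
    qed
    show "signal T l s = 0"
    proof (cases "l \<le> k")
      case False
      then show ?thesis using s opt(1) l by (intro right) auto
    next
      case True
      then have i: "l \<in> {1..k}" using l by auto
      have bd: "0 < s \<Longrightarrow> signal T l s = vec_index (B *\<^sub>v Matrix.vec m (\<lambda>a. signal T (k + 1 + a) s)) (l - 1)"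
        using elim s i by auto
      show ?thesis
      proof (cases "k + 1 < l + m")
        case C: True
        have s1: "\<tau> (m + l) < s" using opt(2)[OF i C] s True by simp
        then have s0: "0 < s" using \<tau>[of "m + l"] i by auto
        have "signal T j s = (\<Sum>a<j - k - 1. vec_index (M (j - m)) a * signal T (k + 1 + a) s)"
          if j: "j \<in> {m + l..k + m}" for j
        proof -
          have "\<tau> j < s" using \<tau>_right_antimono[of "m + l" j] j C s1 by auto
          moreover have "j \<in> {max m k + 1..k + m}" using j C i by auto
          ultimately show ?thesis using elim s s0 by (simp del: atLeastAtMost_iff)
        qed
        then show ?thesis
          unfolding bd[OF s0] by (rule eliminated_row[OF i C])
      next
        \<comment> \<open>Elimination reaches at most \<open>m - 1\<close> rows from below; this row
          lies beyond them and vanishes only because all of its arguments do.\<close>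
        case C: False
        then have s1: "\<tau> (k + 1) < s" using opt(3)[OF i] s True C by simp
        then have s0: "0 < s" using \<tau>[of "k + 1"] m by auto
        show ?thesis
          unfolding bd[OF s0] boundary_value_sum[OF i]
          using right[OF _ s1] by (intro sum.neutral) auto
      qed
    qed
  qed
qed

end

section \<open>Norm estimates\<close>

text \<open>The sum is at most its number of terms times the largest one. After the q-th root the
  constant becomes the cardinality, independent of q.\<close>

lemma powr_sum_le:
  fixes f :: "'a \<Rightarrow> real"
  assumes S: "finite S" and f: "\<And>l. l \<in> S \<Longrightarrow> 0 \<le> f l" and q: "1 \<le> q"
  shows "(\<Sum>l\<in>S. f l) powr q \<le> real (card S) powr q * (\<Sum>l\<in>S. f l powr q)"
proof (cases "S = {}")
  case False
  have fin: "finite (f ` S)" and ne: "f ` S \<noteq> {}" using S False by auto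
  obtain l where l: "l \<in> S" "f l = Max (f ` S)" using Max_in[OF fin ne] by auto
  have "(\<Sum>l\<in>S. f l) \<le> card S * f l"
    using l S by (intro sum_bounded_above) auto
  then have "(\<Sum>l\<in>S. f l) powr q \<le> (card S * f l) powr q"
    using f q by (intro powr_mono2 sum_nonneg) auto
  also have "\<dots> = real (card S) powr q * f l powr q"
    using f l by (simp add: powr_mult)
  also have "\<dots> \<le> real (card S) powr q * (\<Sum>l\<in>S. f l powr q)"
    using l S by (intro mult_left_mono member_le_sum) auto
  finally show ?thesis .
qed simp

lemma nn_integral_lebesgue_on_eq:
  fixes f :: "real \<Rightarrow> ennreal"
  assumes "S \<in> sets borel"
  shows "(\<integral>\<^sup>+ x. f x \<partial>lebesgue_on S) = (\<integral>\<^sup>+ x. f x * indicator S x \<partial>lborel)"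
  using assms by (simp add: nn_integral_restrict_space nn_integral_completion)

text \<open>No integrability is required, as both sides turn an infinite integral into 0. Finiteness
  therefore has to be checked wherever the norms are compared.\<close>

lemma Lq_norm_eq_nn_integral:
  assumes "\<And>l. l \<in> {1..n} \<Longrightarrow> v l \<in> borel_measurable (lebesgue_on {0<..<1})"
  shows "Lq_norm n q v = enn2real (\<Sum>l = 1..n. \<integral>\<^sup>+ x. ennreal (\<bar>v l x\<bar> powr q) \<partial>lebesgue_on {0<..<1}) powr (1 / q)"
proof -
  have "(LINT x|lebesgue_on {0<..<1}. (\<Sum>l = 1..n. \<bar>v l x\<bar> powr q))
      = enn2real (\<integral>\<^sup>+ x. ennreal (\<Sum>l = 1..n. \<bar>v l x\<bar> powr q) \<partial>lebesgue_on {0<..<1})"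
    using assms by (intro integral_eq_nn_integral) (auto intro!: sum_nonneg)
  also have "(\<integral>\<^sup>+ x. ennreal (\<Sum>l = 1..n. \<bar>v l x\<bar> powr q) \<partial>lebesgue_on {0<..<1})
      = (\<Sum>l = 1..n. \<integral>\<^sup>+ x. ennreal (\<bar>v l x\<bar> powr q) \<partial>lebesgue_on {0<..<1})"
    using assms by (subst nn_integral_sum[symmetric]) (auto simp: sum_ennreal)
  finally show ?thesis by (simp add: Lq_norm_def)
qed

lemma Linf_norm_nonneg:
  assumes "1 \<le> n"
  shows "0 \<le> Linf_norm n v"
proof -
  have "(0 :: ereal) = esssup (lebesgue_on {0<..<1 :: real}) (\<lambda>x. 0)"
    by (rule esssup_const[symmetric]) (simp add: emeasure_restrict_space)
  also have "\<dots> \<le> esssup (lebesgue_on {0<..<1}) (\<lambda>x. ereal \<bar>v 1 x\<bar>)"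
    by (rule esssup_mono) auto
  also have "\<dots> \<le> Linf_norm n v"
    unfolding Linf_norm_def using assms by (intro Max_ge) auto
  finally show ?thesis .
qed

lemma Linf_norm_leI:
  assumes n: "1 \<le> n"
    and meas: "\<And>l. l \<in> {1..n} \<Longrightarrow> v l \<in> borel_measurable (lebesgue_on {0<..<1})"
    and ae: "\<And>l. l \<in> {1..n} \<Longrightarrow> AE x in lborel. x \<in> {0<..<1} \<longrightarrow> ereal \<bar>v l x\<bar> \<le> N"
  shows "Linf_norm n v \<le> N"
proof -
  have "esssup (lebesgue_on {0<..<1}) (\<lambda>x. ereal \<bar>v l x\<bar>) \<le> N" if l: "l \<in> {1..n}" for l
  proof (rule esssup_I)
    show "(\<lambda>x. ereal \<bar>v l x\<bar>) \<in> borel_measurable (lebesgue_on {0<..<1})"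
      using meas[OF l] by auto
    show "AE x in lebesgue_on {0<..<1}. ereal \<bar>v l x\<bar> \<le> N"
      using AE_completion[OF ae[OF l]] by (subst AE_restrict_space_iff) auto
  qed
  then show ?thesis
    unfolding Linf_norm_def using n by (intro Max.boundedI) auto
qed

lemma AE_le_Linf_norm:
  assumes "l \<in> {1..n}"
  shows "AE x in lborel. x \<in> {0<..<1} \<longrightarrow> ereal \<bar>v l x\<bar> \<le> Linf_norm n v"
proof -
  have "esssup (lebesgue_on {0<..<1}) (\<lambda>x. ereal \<bar>v l x\<bar>) \<le> Linf_norm n v"
    unfolding Linf_norm_def using assms by (intro Max_ge) auto
  then have "AE x in lebesgue_on {0<..<1}. ereal \<bar>v l x\<bar> \<le> Linf_norm n v"
    using esssup_AE[of "\<lambda>x. ereal \<bar>v l x\<bar>" "lebesgue_on {0<..<1}"] by (auto elim: eventually_mono)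
  then have "AE x in lebesgue. x \<in> {0<..<1} \<longrightarrow> ereal \<bar>v l x\<bar> \<le> Linf_norm n v"
    by (subst (asm) AE_restrict_space_iff) auto
  then show ?thesis by (simp add: AE_completion_iff)
qed

text \<open>The right factor is the pointwise gain \<open>b * A ^ m\<close> times the number of
  terms of the envelope. In the left one, n counts the components of the norm, and \<open>hi\<close>
  and \<open>1 / lo\<close> bound the two Jacobians, from positions to labels and back.\<close>

definition gain_const :: "nat \<Rightarrow> nat \<Rightarrow> real \<Rightarrow> real \<Rightarrow> real \<Rightarrow> real \<Rightarrow> real" where
  "gain_const n m lo hi b A = (real n * hi / lo) * (b * A ^ m * real n)"

lemma gain_const_ge:
  assumes n: "1 \<le> n" and lo: "0 < lo" and hi: "lo \<le> hi" and b: "1 \<le> b" and A: "1 \<le> A"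
  shows "1 \<le> real n * hi / lo" "1 \<le> b * A ^ m * real n"
    "b * A ^ m * real n \<le> gain_const n m lo hi b A" "1 \<le> gain_const n m lo hi b A"
proof -
  have "lo * 1 \<le> hi * real n" using n hi lo by (intro mult_mono) auto
  then show 1: "1 \<le> real n * hi / lo" using lo by (simp add: field_simps)
  have "1 * 1 \<le> b * A ^ m" using A b by (intro mult_mono) auto
  then have "1 * 1 \<le> b * A ^ m * real n" using n by (intro mult_mono) auto
  then show 2: "1 \<le> b * A ^ m * real n" by simp
  show 3: "b * A ^ m * real n \<le> gain_const n m lo hi b A"
    using mult_right_mono[OF 1, of "b * A ^ m * real n"] 2 by (simp add: gain_const_def)
  show "1 \<le> gain_const n m lo hi b A" using 2 3 by linarith
qed

section \<open>Transport of the initial data\<close>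

context closed_loop
begin

lemma w_measurable:
  assumes "l \<in> {1..k + m}" "0 \<le> t"
  shows "w t l \<in> borel_measurable (lebesgue_on {0<..<1})"
proof -
  have "continuous_into_L2 {0..t + 1} {0<..<1} (\<lambda>t x. w t l x)"
    using broad assms by (auto simp: broad_solution_def)
  then have "L2_fun {0<..<1} (\<lambda>x. w t l x)"
    using assms by (auto simp: continuous_into_L2_def)
  then show ?thesis by (simp add: L2_fun_def)
qed

text \<open>The equations along characteristics concern positive times only; the trace at the end t
  = 0 recovers the data.\<close>

lemma w_initial:
  assumes l: "l \<in> {1..k + m}"
  shows "AE x in lborel. x \<in> {0<..<1} \<longrightarrow> w 0 l x = w0 l x"
proof -
  interpret time_change "\<Phi> l" "\<lambda>x. 1 / extend_const (lam l) x" "1 / hi" "1 / lo"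
    by (rule time_change_\<Phi>[OF l])
  have "AE x in lborel. x \<in> {0<..<1} \<longrightarrow> w 0 l x = signal 1 l (0 + \<epsilon> l * \<Phi> l x)"
    by (rule trace_time[OF l]) auto
  then show ?thesis
  proof eventually_elim
    case (elim x)
    show ?case
    proof
      assume x: "x \<in> {0<..<1}"
      then have "0 < \<Phi> l x" "\<Phi> l x < \<tau> l"
        using less[of 0 x] less[of x 1] zero \<Phi>_one[OF l] by auto
      then have "signal 1 l (0 + \<epsilon> l * \<Phi> l x) = initial l x"
        by (simp add: signal_def orientation_def)
      then show "w 0 l x = w0 l x" using elim x by (simp add: initial_def)
    qed
  qed
qed

lemma initial_eq_w:
  assumes l: "l \<in> {1..k + m}"
  shows "AE x in lborel. initial l x = indicator {0<..<1} x * w 0 l x"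
  using w_initial[OF l] by eventually_elim (auto simp: initial_def indicator_def)

lemma initial_travel_AE:
  assumes l: "l \<in> {1..k + m}" and P: "AE x in lborel. P (initial l x)"
  shows "AE s in lborel. P (initial l (inv_into UNIV (\<Phi> l) (\<epsilon> l * s)))"
proof -
  have "AE s in lborel. P (initial l (0 + 1 * inv_into UNIV (\<Phi> l) s))"
    by (rule time_change.AE_affine[OF time_change.inverse_time_change[OF time_change_\<Phi>[OF l]] P]) simp
  then have "AE s in lborel. P (initial l (inv_into UNIV (\<Phi> l) s))" by simp
  from time_change.AE_affine[OF time_change_id this abs_orientation, of 0 k l]
  show ?thesis by simp
qed

lemma initial_travel_nn_integral:
  assumes l: "l \<in> {1..k + m}" and q: "1 \<le> q"
  shows "(\<integral>\<^sup>+ s. ennreal (\<bar>initial l (inv_into UNIV (\<Phi> l) (\<epsilon> l * s))\<bar> powr q) \<partial>lborel)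
      \<le> ennreal (1 / lo) * (\<integral>\<^sup>+ x. ennreal (\<bar>w 0 l x\<bar> powr q) \<partial>lebesgue_on {0<..<1})"
    and "\<exists>f\<in>borel_measurable borel. AE s in lborel. initial l (inv_into UNIV (\<Phi> l) (\<epsilon> l * s)) = f s"
proof -
  interpret time_change "\<Phi> l" "\<lambda>x. 1 / extend_const (lam l) x" "1 / hi" "1 / lo"
    by (rule time_change_\<Phi>[OF l])
  interpret inv: time_change "inv_into UNIV (\<Phi> l)" "\<lambda>s. 1 / (1 / extend_const (lam l) (inv_into UNIV (\<Phi> l) s))"
    "1 / (1 / lo)" "1 / (1 / hi)"
    by (rule inverse_time_change)
  obtain g where g: "integrable lborel g" "AE x in lborel. initial l x = g x"
    using initial_ae_integrable[OF l] by (auto simp: ae_integrable_def)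
  have [measurable]: "g \<in> borel_measurable borel" using g by auto
  have "AE s in lborel. initial l (0 + 1 * inv_into UNIV (\<Phi> l) s) = g (0 + 1 * inv_into UNIV (\<Phi> l) s)"
    by (rule inv.AE_affine[OF g(2)]) simp
  then have "AE s in lborel. initial l (inv_into UNIV (\<Phi> l) s) = g (inv_into UNIV (\<Phi> l) s)" by simp
  from time_change.AE_affine[OF time_change_id this abs_orientation, of 0 k l]
  have ae: "AE s in lborel. initial l (inv_into UNIV (\<Phi> l) (\<epsilon> l * s)) = g (inv_into UNIV (\<Phi> l) (\<epsilon> l * s))"
    by simp
  then show "\<exists>f\<in>borel_measurable borel. AE s in lborel. initial l (inv_into UNIV (\<Phi> l) (\<epsilon> l * s)) = f s"
    by (intro bexI[of _ "\<lambda>s. g (inv_into UNIV (\<Phi> l) (\<epsilon> l * s))"]) auto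
  have "(\<integral>\<^sup>+ s. ennreal (\<bar>initial l (inv_into UNIV (\<Phi> l) (\<epsilon> l * s))\<bar> powr q) \<partial>lborel)
      = (\<integral>\<^sup>+ s. ennreal (\<bar>g (inv_into UNIV (\<Phi> l) (\<epsilon> l * s))\<bar> powr q) \<partial>lborel)"
    using ae by (intro nn_integral_cong_AE) auto
  \<comment> \<open>Substitutes s = \<open>\<epsilon> l * \<Phi> l x\<close>; the sign squares to 1
    and the inverse clock cancels.\<close>
  also have "\<dots> = (\<integral>\<^sup>+ x. ennreal (1 / extend_const (lam l) x) *
      ennreal (\<bar>g (inv_into UNIV (\<Phi> l) (\<epsilon> l * (0 + \<epsilon> l * \<Phi> l x)))\<bar> powr q) \<partial>lborel)"
    by (rule nn_integral_affine[symmetric]) auto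
  also have "\<dots> = (\<integral>\<^sup>+ x. ennreal (1 / extend_const (lam l) x) * ennreal (\<bar>g x\<bar> powr q) \<partial>lborel)"
    by (simp add: orientation_def)
  also have "\<dots> \<le> (\<integral>\<^sup>+ x. ennreal (1 / lo) * ennreal (\<bar>g x\<bar> powr q) \<partial>lborel)"
    using up by (intro nn_integral_mono mult_right_mono ennreal_leI) auto
  also have "\<dots> = ennreal (1 / lo) * (\<integral>\<^sup>+ x. ennreal (\<bar>g x\<bar> powr q) \<partial>lborel)"
    by (intro nn_integral_cmult) auto
  also have "(\<integral>\<^sup>+ x. ennreal (\<bar>g x\<bar> powr q) \<partial>lborel)
      = (\<integral>\<^sup>+ x. ennreal (\<bar>w 0 l x\<bar> powr q) * indicator {0<..<1} x \<partial>lborel)"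
  proof (rule nn_integral_cong_AE)
    show "AE x in lborel. ennreal (\<bar>g x\<bar> powr q) = ennreal (\<bar>w 0 l x\<bar> powr q) * indicator {0<..<1} x"
      using g(2) initial_eq_w[OF l]
    proof eventually_elim
      case (elim x)
      then have "g x = indicator {0<..<1} x * w 0 l x" by simp
      then show ?case using q by (simp add: indicator_def)
    qed
  qed
  also have "\<dots> = (\<integral>\<^sup>+ x. ennreal (\<bar>w 0 l x\<bar> powr q) \<partial>lebesgue_on {0<..<1})"
    by (rule nn_integral_lebesgue_on_eq[symmetric]) simp
  finally show "(\<integral>\<^sup>+ s. ennreal (\<bar>initial l (inv_into UNIV (\<Phi> l) (\<epsilon> l * s))\<bar> powr q) \<partial>lborel)
      \<le> ennreal (1 / lo) * (\<integral>\<^sup>+ x. ennreal (\<bar>w 0 l x\<bar> powr q) \<partial>lebesgue_on {0<..<1})" .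
qed

lemma envelope_nn_integral:
  assumes q: "1 \<le> q"
  shows "(\<integral>\<^sup>+ s. ennreal (envelope s powr q) \<partial>lborel)
    \<le> ennreal (real (k + m) powr q / lo) * (\<Sum>l = 1..k + m. \<integral>\<^sup>+ x. ennreal (\<bar>w 0 l x\<bar> powr q) \<partial>lebesgue_on {0<..<1})"
proof -
  let ?I = "\<lambda>l s. initial l (inv_into UNIV (\<Phi> l) (\<epsilon> l * s))"
  let ?E = "\<lambda>l. \<integral>\<^sup>+ x. ennreal (\<bar>w 0 l x\<bar> powr q) \<partial>lebesgue_on {0<..<1}"
  obtain f where f: "\<And>l. l \<in> {1..k + m} \<Longrightarrow> f l \<in> borel_measurable borel"
    "\<And>l. l \<in> {1..k + m} \<Longrightarrow> AE s in lborel. ?I l s = f l s"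
    using initial_travel_nn_integral(2)[OF _ q] by metis
  have "AE s in lborel. \<forall>l\<in>{1..k + m}. ?I l s = f l s"
    using f(2) by (intro eventually_ball_finite) auto
  then have "AE s in lborel. ennreal (envelope s powr q)
      \<le> ennreal (real (k + m) powr q) * (\<Sum>l = 1..k + m. ennreal (\<bar>f l s\<bar> powr q))"
  proof eventually_elim
    case (elim s)
    have "envelope s powr q \<le> real (card {1..k + m}) powr q * (\<Sum>l = 1..k + m. \<bar>?I l s\<bar> powr q)"
      unfolding envelope_def by (rule powr_sum_le) (use q in auto)
    also have "\<dots> = real (k + m) powr q * (\<Sum>l = 1..k + m. \<bar>f l s\<bar> powr q)"
      using elim by simp
    finally show ?case
      by (simp add: sum_ennreal sum_nonneg ennreal_mult[symmetric] ennreal_leI)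
  qed
  then have "(\<integral>\<^sup>+ s. ennreal (envelope s powr q) \<partial>lborel)
      \<le> (\<integral>\<^sup>+ s. ennreal (real (k + m) powr q) * (\<Sum>l = 1..k + m. ennreal (\<bar>f l s\<bar> powr q)) \<partial>lborel)"
    by (rule nn_integral_mono_AE)
  also have "\<dots> = ennreal (real (k + m) powr q) * (\<Sum>l = 1..k + m. \<integral>\<^sup>+ s. ennreal (\<bar>f l s\<bar> powr q) \<partial>lborel)"
  proof -
    have meas: "(\<lambda>s. ennreal (\<bar>f l s\<bar> powr q)) \<in> borel_measurable lborel" if "l \<in> {1..k + m}" for l
      using f(1)[OF that] by simp
    show ?thesis
      by (subst nn_integral_cmult, use meas in \<open>simp add: borel_measurable_sum del: sum_ennreal\<close>)
        (subst nn_integral_sum, use meas in auto)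
  qed
  also have "\<dots> \<le> ennreal (real (k + m) powr q) * (\<Sum>l = 1..k + m. ennreal (1 / lo) * ?E l)"
  proof (intro mult_left_mono sum_mono)
    fix l assume l: "l \<in> {1..k + m}"
    have "(\<integral>\<^sup>+ s. ennreal (\<bar>f l s\<bar> powr q) \<partial>lborel) = (\<integral>\<^sup>+ s. ennreal (\<bar>?I l s\<bar> powr q) \<partial>lborel)"
      using f(2)[OF l] by (intro nn_integral_cong_AE) auto
    also have "\<dots> \<le> ennreal (1 / lo) * ?E l"
      by (rule initial_travel_nn_integral(1)[OF l q])
    finally show "(\<integral>\<^sup>+ s. ennreal (\<bar>f l s\<bar> powr q) \<partial>lborel) \<le> ennreal (1 / lo) * ?E l" .
  qed simp
  also have "\<dots> = ennreal (real (k + m) powr q / lo) * (\<Sum>l = 1..k + m. ?E l)"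
    using lo by (simp add: sum_distrib_left[symmetric] mult.assoc[symmetric] ennreal_mult[symmetric])
  finally show ?thesis .
qed

text \<open>Bounded data on an interval of finite length. Without finiteness \<open>enn2real\<close>
  would not be monotone in the final comparison.\<close>

lemma initial_energy_finite:
  assumes l: "l \<in> {1..k + m}" and q: "1 \<le> q"
  shows "(\<integral>\<^sup>+ x. ennreal (\<bar>w 0 l x\<bar> powr q) \<partial>lebesgue_on {0<..<1}) < \<infinity>"
proof -
  obtain K where K: "AE x in lebesgue_on {0<..<1}. \<bar>w0 l x\<bar> \<le> K"
    using data[OF l] by (auto simp: Linf_fun_def)
  have "AE x in lebesgue_on {0<..<1}. w 0 l x = w0 l x"
    using AE_completion[OF w_initial[OF l]] by (subst AE_restrict_space_iff) auto
  with K have "AE x in lebesgue_on {0<..<1}. ennreal (\<bar>w 0 l x\<bar> powr q) \<le> ennreal (K powr q)"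
    by eventually_elim (use q in \<open>auto intro!: ennreal_leI powr_mono2\<close>)
  then have "(\<integral>\<^sup>+ x. ennreal (\<bar>w 0 l x\<bar> powr q) \<partial>lebesgue_on {0<..<1})
      \<le> (\<integral>\<^sup>+ x. ennreal (K powr q) \<partial>lebesgue_on {0<..<1 :: real})"
    by (rule nn_integral_mono_AE)
  also have "\<dots> < \<infinity>"
    by (simp add: emeasure_restrict_space)
  finally show ?thesis .
qed

end

section \<open>Estimates of the solution\<close>

context closed_loop_gain
begin

lemma w_bound_AE:
  assumes l: "l \<in> {1..k + m}" and t: "0 \<le> t"
  shows "AE x in lborel. x \<in> {0<..<1} \<longrightarrow> \<bar>w t l x\<bar> \<le> b * A ^ m * envelope (t + \<epsilon> l * \<Phi> l x)"
proof -
  interpret time_change "\<Phi> l" "\<lambda>x. 1 / extend_const (lam l) x" "1 / hi" "1 / lo"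
    by (rule time_change_\<Phi>[OF l])
  \<comment> \<open>All labels at time \<open>t\<close> lie below \<open>t + \<tau> l\<close>, so
    this horizon keeps the cut-off out of sight.\<close>
  define T where "T = t + \<tau> l + 1"
  have T: "0 < T" "t \<in> {0..T}" using t \<tau>_pos[OF l] by (auto simp: T_def)
  show ?thesis
    using trace_time[OF l T] AE_affine[OF signal_bound[OF l T(1)] abs_orientation, of t k l]
  proof eventually_elim
    case (elim x)
    show ?case
    proof
      assume x: "x \<in> {0<..<1}"
      then have "0 < \<Phi> l x" "\<Phi> l x < \<tau> l"
        using less[of 0 x] less[of x 1] zero \<Phi>_one[OF l] by auto
      then have "t + \<epsilon> l * \<Phi> l x < T" "l \<le> k \<or> 0 < t + \<epsilon> l * \<Phi> l x"
        using t \<tau>_pos[OF l] by (auto simp: T_def orientation_def)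
      then show "\<bar>w t l x\<bar> \<le> b * A ^ m * envelope (t + \<epsilon> l * \<Phi> l x)"
        using elim x by simp
    qed
  qed
qed

lemma w_vanishes_AE:
  assumes l: "l \<in> {1..k + m}" and t: "0 \<le> t" "T_opt k m lam < t"
  shows "AE x in lborel. x \<in> {0<..<1} \<longrightarrow> w t l x = 0"
proof -
  interpret time_change "\<Phi> l" "\<lambda>x. 1 / extend_const (lam l) x" "1 / hi" "1 / lo"
    by (rule time_change_\<Phi>[OF l])
  define T where "T = t + \<tau> l + 1"
  have T: "0 < T" "t \<in> {0..T}" using t \<tau>_pos[OF l] by (auto simp: T_def)
  show ?thesis
    using trace_time[OF l T] AE_affine[OF signal_vanishes[OF l T(1)] abs_orientation, of t k l]
  proof eventually_elim
    case (elim x)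
    show ?case
    proof
      assume x: "x \<in> {0<..<1}"
      then have "0 < \<Phi> l x" "\<Phi> l x < \<tau> l"
        using less[of 0 x] less[of x 1] zero \<Phi>_one[OF l] by auto
      then have "t + \<epsilon> l * \<Phi> l x < T" "T_opt k m lam - (if l \<le> k then \<tau> l else 0) < t + \<epsilon> l * \<Phi> l x"
        using t \<tau>_pos[OF l] by (auto simp: T_def orientation_def)
      then show "w t l x = 0"
        using elim x by simp
    qed
  qed
qed

lemma Lq_norm_vanishes:
  assumes t: "0 \<le> t" "T_opt k m lam < t" and q: "1 \<le> q"
  shows "Lq_norm (k + m) q (w t) = 0"
proof -
  have "(\<integral>\<^sup>+ x. ennreal (\<bar>w t l x\<bar> powr q) \<partial>lebesgue_on {0<..<1}) = 0" if l: "l \<in> {1..k + m}" for l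
  proof -
    have "(\<integral>\<^sup>+ x. ennreal (\<bar>w t l x\<bar> powr q) * indicator {0<..<1} x \<partial>lborel) = (\<integral>\<^sup>+ x. 0 \<partial>(lborel :: real measure))"
      using w_vanishes_AE[OF l t] by (intro nn_integral_cong_AE) (auto simp: indicator_def elim!: eventually_mono)
    then show ?thesis by (simp add: nn_integral_lebesgue_on_eq)
  qed
  then have "(\<Sum>l = 1..k + m. \<integral>\<^sup>+ x. ennreal (\<bar>w t l x\<bar> powr q) \<partial>lebesgue_on {0<..<1}) = 0"
    by (intro sum.neutral) auto
  then show ?thesis
    by (subst Lq_norm_eq_nn_integral) (use w_measurable t q in auto)
qed

lemma hi_pos: "0 < hi" "lo \<le> hi"
  using speed_bounds[of 1 0] lo k by auto

lemma w_nn_integral_bound: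
  assumes l: "l \<in> {1..k + m}" and t: "0 \<le> t" and q: "1 \<le> q"
  shows "(\<integral>\<^sup>+ x. ennreal (\<bar>w t l x\<bar> powr q) \<partial>lebesgue_on {0<..<1})
    \<le> ennreal (hi * (b * A ^ m) powr q) * (\<integral>\<^sup>+ s. ennreal (envelope s powr q) \<partial>lborel)"
proof -
  interpret time_change "\<Phi> l" "\<lambda>x. 1 / extend_const (lam l) x" "1 / hi" "1 / lo"
    by (rule time_change_\<Phi>[OF l])
  let ?K = "b * A ^ m" and ?p = "\<lambda>x. 1 / extend_const (lam l) x"
  have K: "0 \<le> ?K" using A b by simp
  have "\<exists>f\<in>borel_measurable borel. AE s in lborel. initial l (inv_into UNIV (\<Phi> l) (\<epsilon> l * s)) = f s"
    if "l \<in> {1..k + m}" for l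
    using initial_travel_nn_integral(2)[OF that q] .
  then obtain f where f: "\<And>l. l \<in> {1..k + m} \<Longrightarrow> f l \<in> borel_measurable borel"
    "\<And>l. l \<in> {1..k + m} \<Longrightarrow> AE s in lborel. initial l (inv_into UNIV (\<Phi> l) (\<epsilon> l * s)) = f l s"
    by metis
  \<comment> \<open>A Borel representative of the envelope, as required for the
    substitution.\<close>
  define h where "h s = (\<Sum>l\<in>{1..k + m}. \<bar>f l s\<bar>)" for s
  have [measurable]: "h \<in> borel_measurable borel"
    unfolding h_def using f(1) by auto
  have "AE s in lborel. \<forall>l\<in>{1..k + m}. initial l (inv_into UNIV (\<Phi> l) (\<epsilon> l * s)) = f l s"
    using f(2) by (intro eventually_ball_finite) auto
  then have env: "AE s in lborel. envelope s = h s"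
    by eventually_elim (simp add: envelope_def h_def)
  have "(\<integral>\<^sup>+ x. ennreal (\<bar>w t l x\<bar> powr q) \<partial>lebesgue_on {0<..<1})
      = (\<integral>\<^sup>+ x. ennreal (\<bar>w t l x\<bar> powr q) * indicator {0<..<1} x \<partial>lborel)"
    by (rule nn_integral_lebesgue_on_eq) simp
  also have "\<dots> \<le> (\<integral>\<^sup>+ x. ennreal (?p x) * (ennreal (hi * ?K powr q) * ennreal (h (t + \<epsilon> l * \<Phi> l x) powr q)) \<partial>lborel)"
  proof (rule nn_integral_mono_AE)
    show "AE x in lborel. ennreal (\<bar>w t l x\<bar> powr q) * indicator {0<..<1} x
        \<le> ennreal (?p x) * (ennreal (hi * ?K powr q) * ennreal (h (t + \<epsilon> l * \<Phi> l x) powr q))"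
      using w_bound_AE[OF l t] AE_affine[OF env abs_orientation, of t k l]
    proof eventually_elim
      case (elim x)
      show ?case
      proof (cases "x \<in> {0<..<1}")
        case True
        let ?h = "h (t + \<epsilon> l * \<Phi> l x)"
        have h0: "0 \<le> ?h" using elim(2) envelope_nonneg by metis
        have "\<bar>w t l x\<bar> powr q \<le> (?K * ?h) powr q"
          using elim True q by (intro powr_mono2) auto
        also have "\<dots> = ?K powr q * ?h powr q"
          using K h0 by (simp add: powr_mult)
        \<comment> \<open>Inserts the Jacobian at the price of \<open>hi\<close>, since
          \<open>?p x\<close> is at least \<open>1 / hi\<close>.\<close>
        also have "\<dots> \<le> (?p x * hi) * (?K powr q * ?h powr q)"
          using mult_right_mono[of 1 "?p x * hi" "?K powr q * ?h powr q"] low[of x] hi_pos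
          by (auto simp: field_simps)
        finally have "\<bar>w t l x\<bar> powr q \<le> ?p x * (hi * ?K powr q * ?h powr q)"
          by (simp add: mult_ac)
        then have "ennreal (\<bar>w t l x\<bar> powr q) \<le> ennreal (?p x * (hi * ?K powr q * ?h powr q))"
          by (rule ennreal_leI)
        also have "\<dots> = ennreal (?p x) * (ennreal (hi * ?K powr q) * ennreal (?h powr q))"
          using pos[of x] hi_pos by (subst ennreal_mult) (auto simp: ennreal_mult less_imp_le)
        finally show ?thesis using True by simp
      qed simp
    qed
  qed
  also have "\<dots> = (\<integral>\<^sup>+ s. ennreal (hi * ?K powr q) * ennreal (h s powr q) \<partial>lborel)"
    by (rule nn_integral_affine) auto
  also have "\<dots> = ennreal (hi * ?K powr q) * (\<integral>\<^sup>+ s. ennreal (h s powr q) \<partial>lborel)"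
    by (rule nn_integral_cmult) auto
  also have "(\<integral>\<^sup>+ s. ennreal (h s powr q) \<partial>lborel) = (\<integral>\<^sup>+ s. ennreal (envelope s powr q) \<partial>lborel)"
    using env by (intro nn_integral_cong_AE) auto
  finally show ?thesis .
qed

abbreviation C :: real where "C \<equiv> gain_const (k + m) m lo hi b A"

lemma one_le_n: "1 \<le> k + m"
  using k by simp

lemma C_ge:
  "1 \<le> real (k + m) * hi / lo" "1 \<le> b * A ^ m * real (k + m)"
  "b * A ^ m * real (k + m) \<le> C" "1 \<le> C"
  by (rule gain_const_ge[OF one_le_n lo hi_pos(2) b A])+

lemma Lq_norm_bound:
  assumes t: "0 \<le> t" and q: "1 \<le> q"
  shows "Lq_norm (k + m) q (w t) \<le> C * Lq_norm (k + m) q (w 0)"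
proof -
  let ?E = "\<lambda>t. \<Sum>l = 1..k + m. \<integral>\<^sup>+ x. ennreal (\<bar>w t l x\<bar> powr q) \<partial>lebesgue_on {0<..<1}"
  define R where "R = real (k + m) * hi / lo"
  define K where "K = b * A ^ m * real (k + m)"
  have R: "1 \<le> R" and K: "1 \<le> K" using C_ge by (auto simp: R_def K_def)
  have K': "0 \<le> b * A ^ m" using A b by simp
  have "?E t \<le> (\<Sum>l = 1..k + m. ennreal (hi * (b * A ^ m) powr q) *
      (ennreal (real (k + m) powr q / lo) * ?E 0))"
    by (intro sum_mono order_trans[OF w_nn_integral_bound[OF _ t q]] mult_left_mono envelope_nn_integral q) auto
  also have "\<dots> = ennreal (R * K powr q) * ?E 0"
  proof -
    have "R * K powr q = real (k + m) * ((hi * (b * A ^ m) powr q) * (real (k + m) powr q / lo))"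
      using K' by (simp add: R_def K_def powr_mult)
    moreover have "0 \<le> hi * (b * A ^ m) powr q" "0 \<le> real (k + m) powr q / lo"
      using hi_pos lo by auto
    ultimately have "ennreal (R * K powr q) = of_nat (k + m) *
        (ennreal (hi * (b * A ^ m) powr q) * ennreal (real (k + m) powr q / lo))"
      by (simp only: ennreal_of_nat_eq_real_of_nat ennreal_mult mult_nonneg_nonneg of_nat_0_le_iff)
    then show ?thesis by (simp add: mult.assoc)
  qed
  finally have le: "?E t \<le> ennreal (R * K powr q) * ?E 0" .
  have fin: "?E 0 < \<infinity>"
    using initial_energy_finite[OF _ q] by (simp add: less_top)
  have "enn2real (?E t) \<le> enn2real (ennreal (R * K powr q) * ?E 0)"
    by (rule enn2real_mono[OF le]) (use fin in \<open>simp add: ennreal_mult_less_top\<close>)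
  also have "\<dots> = R * K powr q * enn2real (?E 0)"
    using R by (simp add: enn2real_mult)
  finally have "enn2real (?E t) powr (1 / q) \<le> (R * K powr q * enn2real (?E 0)) powr (1 / q)"
    using q by (intro powr_mono2) auto
  also have "\<dots> = R powr (1 / q) * K * enn2real (?E 0) powr (1 / q)"
    using R K q by (simp add: powr_mult powr_powr)
  \<comment> \<open>Here the dependence on q disappears: \<open>R \<ge> 1\<close> and
    \<open>1 / q \<le> 1\<close>.\<close>
  also have "\<dots> \<le> R * K * enn2real (?E 0) powr (1 / q)"
  proof -
    have "R powr (1 / q) \<le> R powr 1" using R q by (intro powr_mono) auto
    then show ?thesis using R K by (intro mult_right_mono) auto
  qed
  also have "R * K = C" by (simp add: R_def K_def gain_const_def)
  finally show ?thesis
    using Lq_norm_eq_nn_integral[of "k + m" "w t" q, OF w_measurable[OF _ t]]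
      Lq_norm_eq_nn_integral[of "k + m" "w 0" q, OF w_measurable] by simp
qed

text \<open>The envelope has \<open>k + m\<close> terms, each at most the initial sup norm almost
  everywhere. The pointwise bound then needs only the right factor of \<open>gain_const\<close>,
  which \<open>C\<close> dominates.\<close>

lemma Linf_norm_bound:
  assumes t: "0 \<le> t"
  shows "Linf_norm (k + m) (w t) \<le> ereal C * Linf_norm (k + m) (w 0)"
proof (cases "Linf_norm (k + m) (w 0) = \<infinity>")
  case True
  then show ?thesis using C_ge(4) by simp
next
  case False
  have n: "1 \<le> k + m" using k by simp
  from False Linf_norm_nonneg[OF n, of "w 0"]
  obtain N where N: "Linf_norm (k + m) (w 0) = ereal N" "0 \<le> N"
    by (cases "Linf_norm (k + m) (w 0)") auto
  have init: "AE s in lborel. \<bar>initial l (inv_into UNIV (\<Phi> l) (\<epsilon> l * s))\<bar> \<le> N" if l: "l \<in> {1..k + m}" for l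
  proof (rule initial_travel_AE[OF l])
    show "AE x in lborel. \<bar>initial l x\<bar> \<le> N"
      using initial_eq_w[OF l] AE_le_Linf_norm[OF l, of "w 0"]
      by eventually_elim (use N in \<open>auto simp: indicator_def\<close>)
  qed
  have "AE s in lborel. \<forall>l\<in>{1..k + m}. \<bar>initial l (inv_into UNIV (\<Phi> l) (\<epsilon> l * s))\<bar> \<le> N"
    using init by (intro eventually_ball_finite) auto
  then have env: "AE s in lborel. envelope s \<le> real (k + m) * N"
  proof eventually_elim
    case (elim s)
    then have "envelope s \<le> real (card {1..k + m}) * N"
      unfolding envelope_def by (intro sum_bounded_above) auto
    then show ?case by simp
  qed
  show ?thesis
    unfolding N(1)
  proof (rule Linf_norm_leI[OF n w_measurable[OF _ t]])
    fix l assume l: "l \<in> {1..k + m}"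
    interpret time_change "\<Phi> l" "\<lambda>x. 1 / extend_const (lam l) x" "1 / hi" "1 / lo"
      by (rule time_change_\<Phi>[OF l])
    show "AE x in lborel. x \<in> {0<..<1} \<longrightarrow> ereal \<bar>w t l x\<bar> \<le> ereal C * ereal N"
      using w_bound_AE[OF l t] AE_affine[OF env abs_orientation, of t k l]
    proof eventually_elim
      case (elim x)
      show ?case
      proof
        assume "x \<in> {0<..<1}"
        then have "\<bar>w t l x\<bar> \<le> b * A ^ m * envelope (t + \<epsilon> l * \<Phi> l x)" using elim by simp
        also have "\<dots> \<le> b * A ^ m * (real (k + m) * N)"
          using elim A b by (intro mult_left_mono) auto
        also have "\<dots> = (b * A ^ m * real (k + m)) * N" by simp
        also have "\<dots> \<le> C * N"
          using C_ge(3) N by (intro mult_right_mono) auto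
        finally show "ereal \<bar>w t l x\<bar> \<le> ereal C * ereal N" by simp
      qed
    qed
  qed
qed

lemma Lq_norm_decay:
  assumes t: "0 \<le> t" and q: "1 \<le> q" and \<Lambda>: "1 \<le> \<Lambda>"
  shows "Lq_norm (k + m) q (w t) \<le> C * exp (\<Lambda> * (T_opt k m lam - t)) * Lq_norm (k + m) q (w 0)"
proof (cases "t \<le> T_opt k m lam")
  case True
  have N: "0 \<le> Lq_norm (k + m) q (w 0)" by (simp add: Lq_norm_def)
  have "1 \<le> exp (\<Lambda> * (T_opt k m lam - t))" using True \<Lambda> by simp
  then have "C * 1 * Lq_norm (k + m) q (w 0)
      \<le> C * exp (\<Lambda> * (T_opt k m lam - t)) * Lq_norm (k + m) q (w 0)"
    using C_ge(4) N by (intro mult_right_mono mult_left_mono) auto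
  then show ?thesis using Lq_norm_bound[OF t q] by simp
next
  case False
  have "0 \<le> C * exp (\<Lambda> * (T_opt k m lam - t)) * Lq_norm (k + m) q (w 0)"
    using C_ge(4) by (simp add: Lq_norm_def)
  then show ?thesis using Lq_norm_vanishes[OF t _ q] False by simp
qed

lemma Linf_norm_decay:
  assumes t: "0 \<le> t" and \<Lambda>: "1 \<le> \<Lambda>"
  shows "Linf_norm (k + m) (w t) \<le> ereal (C * exp (\<Lambda> * (T_opt k m lam - t))) * Linf_norm (k + m) (w 0)"
proof -
  have n: "1 \<le> k + m" using k by simp
  note N = Linf_norm_nonneg[OF n, of "w 0"]
  show ?thesis
  proof (cases "t \<le> T_opt k m lam")
    case True
    have "1 \<le> exp (\<Lambda> * (T_opt k m lam - t))" using True \<Lambda> by simp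
    then have "C * 1 \<le> C * exp (\<Lambda> * (T_opt k m lam - t))"
      using C_ge(4) by (intro mult_left_mono) auto
    then have "ereal C * Linf_norm (k + m) (w 0)
        \<le> ereal (C * exp (\<Lambda> * (T_opt k m lam - t))) * Linf_norm (k + m) (w 0)"
      using N by (intro ereal_mult_right_mono) auto
    then show ?thesis using Linf_norm_bound[OF t] by (rule order_trans[rotated])
  next
    case False
    have "Linf_norm (k + m) (w t) \<le> 0"
      by (rule Linf_norm_leI[OF n w_measurable[OF _ t]])
        (use w_vanishes_AE[OF _ t] False in \<open>auto elim!: eventually_mono\<close>)
    also have "0 \<le> ereal (C * exp (\<Lambda> * (T_opt k m lam - t))) * Linf_norm (k + m) (w 0)"
      using N C_ge(4) by (intro ereal_0_le_mult) auto
    finally show ?thesis .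
  qed
qed

end

theorem theorem1p1:
  fixes k m :: nat
    and lam :: "nat \<Rightarrow> real \<Rightarrow> real"
    and B :: "real mat"
  assumes "k \<ge> 1" and "m \<ge> 1"
    and "hyperbolic_speeds k m lam"
    and "B \<in> B_set k m"
  shows "\<exists>C::real. C \<ge> 1 \<and>
    (\<forall>X M w0 w.
       characteristics k m lam X \<longrightarrow>
       elimination_rows k m B M \<longrightarrow>
       (\<forall>i\<in>{1..k + m}. Linf_fun {0<..<1} (w0 i)) \<longrightarrow>
       broad_solution k m lam B X M w0 w \<longrightarrow>
         (\<forall>q\<ge>1. \<forall>\<Lambda>\<ge>1. \<forall>t\<ge>0.
            Lq_norm (k + m) q (w t)
              \<le> C * exp (\<Lambda> * (T_opt k m lam - t)) * Lq_norm (k + m) q (w 0)) \<and>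
         (\<forall>\<Lambda>\<ge>1. \<forall>t\<ge>0.
            Linf_norm (k + m) (w t)
              \<le> ereal (C * exp (\<Lambda> * (T_opt k m lam - t))) * Linf_norm (k + m) (w 0)))"
proof -
  obtain lo hi where speeds: "0 < lo" "lo \<le> hi"
    "\<And>i x. i \<in> {1..k + m} \<Longrightarrow> x \<in> {0..1} \<Longrightarrow> lo \<le> lam i x \<and> lam i x \<le> hi"
    using hyperbolic_speeds_bounds[OF assms(3)] by blast
  obtain A where A: "A \<ge> 1" "\<And>M j. elimination_rows k m B M \<Longrightarrow> j \<in> {max m k + 1..k + m} \<Longrightarrow>
      (\<Sum>a<j - k - 1. \<bar>vec_index (M (j - m)) a\<bar>) \<le> A"
    using elimination_rows_bound[OF assms(1,2)] by blast
  \<comment> \<open>The sum of all absolute entries dominates every row sum, and the added 1 makes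
    \<open>b \<ge> 1\<close>.\<close>
  define b where "b = 1 + (\<Sum>i = 1..k. \<Sum>a<m. \<bar>B $$ (i - 1, a)\<bar>)"
  have b: "1 \<le> b" by (auto simp: b_def intro!: sum_nonneg)
  have b': "(\<Sum>a<m. \<bar>B $$ (i - 1, a)\<bar>) \<le> b" if "i \<in> {1..k}" for i
    using member_le_sum[of i "{1..k}" "\<lambda>i. \<Sum>a<m. \<bar>B $$ (i - 1, a)\<bar>"] that
    by (auto simp: b_def sum_nonneg)
  have carrier: "B \<in> carrier_mat k m" using assms(4) by (simp add: B_set_def)
  \<comment> \<open>All ingredients depend on the speeds and \<open>B\<close> only, as they are
    obtained before \<open>X\<close>, \<open>M\<close>, \<open>w0\<close> and \<open>w\<close> are
    introduced.\<close>
  define C where "C = gain_const (k + m) m lo hi b A"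
  have loop: "closed_loop_gain k m lam B X M w0 w lo hi A b"
    if "characteristics k m lam X" "elimination_rows k m B M"
      "\<forall>i\<in>{1..k + m}. Linf_fun {0<..<1} (w0 i)" "broad_solution k m lam B X M w0 w" for X M w0 w
    using that assms speeds A b b' carrier by unfold_locales auto
  have "1 \<le> C"
    unfolding C_def using speeds(1,2) b A(1) assms(1) by (intro gain_const_ge(4)) auto
  moreover have "Lq_norm (k + m) q (w t) \<le> C * exp (\<Lambda> * (T_opt k m lam - t)) * Lq_norm (k + m) q (w 0)"
    if "characteristics k m lam X" "elimination_rows k m B M"
      "\<forall>i\<in>{1..k + m}. Linf_fun {0<..<1} (w0 i)" "broad_solution k m lam B X M w0 w"
      "1 \<le> q" "1 \<le> \<Lambda>" "0 \<le> t" for X M w0 w q \<Lambda> t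
    using closed_loop_gain.Lq_norm_decay[OF loop[OF that(1-4)] that(7,5,6)]
    by (simp add: C_def)
  moreover have "Linf_norm (k + m) (w t) \<le> ereal (C * exp (\<Lambda> * (T_opt k m lam - t))) * Linf_norm (k + m) (w 0)"
    if "characteristics k m lam X" "elimination_rows k m B M"
      "\<forall>i\<in>{1..k + m}. Linf_fun {0<..<1} (w0 i)" "broad_solution k m lam B X M w0 w"
      "1 \<le> \<Lambda>" "0 \<le> t" for X M w0 w \<Lambda> t
    using closed_loop_gain.Linf_norm_decay[OF loop[OF that(1-4)] that(6,5)]
    by (simp add: C_def)
  ultimately show ?thesis by blast
qed

end
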